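(* Let $x\in\mathbb{C}\setminus(\mathbb{R}^-\cup\{1\})$ and let $\nu\in\mathbb{C}$ with $\mathrm{Re}(\nu)<0$. Let $\mathscr{H}_0$ and $\mathfrak{L}:\mathscr{H}_0\to\mathscr{H}_0$ be as defined in the context. Given $K\in\mathscr{H}_0$, the unique solution $E^*=\mathfrak{L}^{-1}K\in\mathscr{H}_0$ of the equation $\mathfrak{L}E^*=K$ has the equivalent integral representations $$E^*(z)=\frac{1-x}{2i\pi x}\,e^{(1-x)z}\int_0^{(1+)}\frac{e^{xtz}}{t(1-t)}\,K\left(z\,t^{1-\nu}(t-1)^{\nu}\right)\mathrm{d}t,\qquad z\in\mathbb{C},$$ where the contour in the variable $t$ is a loop starting and ending at the point $t=0$ and encircling the point $t=1$ once in the positive sense, and $$E^*(z)=\frac{1-x}{2i\pi x}\,e^{(1-x)z}\int_{c_0-i\infty}^{c_0+i\infty}\frac{e^{xz/r}}{r-1}\,K\left(\frac{z(1-r)^{\nu}}{r}\right)\mathrm{d}r,\qquad z\in\mathbb{C},$$ where the contour is the vertical line $\mathrm{Re}(r)=c_0$, for any real abscissa $c_0$ with $0<c_0<1$.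
   Context: $\mathbb{R}^-=(-\infty,0]$. $\mathscr{H}_0$ is the complex linear space of entire functions on $\mathbb{C}$ vanishing at $0$. For $x\in\mathbb{C}\setminus(\mathbb{R}^-\cup\{1\})$ and $\mathrm{Re}(\nu)<0$, set $$\mathfrak{R}(\zeta)=x(1-\zeta)^{-\nu}\left(1-(1-x)\zeta\right)^{\nu-1},\quad \zeta\in[0,1],\qquad c=\frac{1-\nu x}{1-x},$$ with principal powers, and define the operator $\mathfrak{L}:\mathscr{H}_0\to\mathscr{H}_0$ by $$\mathfrak{L}f(z)=\int_0^1\left[(1+z\,\mathfrak{R}(\zeta))\,f(\zeta\,\mathfrak{R}(\zeta)\,z)-c\,z\,\mathfrak{R}(\zeta)\,f'(\zeta\,\mathfrak{R}(\zeta)\,z)\right]e^{-\mathfrak{R}(\zeta)z}\,\mathrm{d}\zeta,\qquad z\in\mathbb{C},$$ where $f'$ is the derivative of $f$. This operator is a bijection of $\mathscr{H}_0$ onto itself, so that $\mathfrak{L}^{-1}$ makes sense. Contour and branch conventions: $\int_0^{(1+)}$ denotes integration along a bounded (piecewise smooth) simple loop which starts at $t=0$ (entering the lower half-plane), goes once counterclockwise around $1$, and returns to $t=0$ (from the upper half-plane), lying in $\mathbb{C}\setminus(-\infty,1]$ except for its endpoint $t=0$. All powers are principal: $|\arg t|<\pi$ and $|\arg(t-1)|<\pi$ on this loop, and $|\arg(1-r)|<\pi$ on the line $\mathrm{Re}(r)=c_0$, which is oriented upwards. *)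

theory Defs
  imports "HOL-Complex_Analysis.Complex_Analysis"
begin

definition H0 :: "(complex \<Rightarrow> complex) set" where
  "H0 = {f. f holomorphic_on UNIV \<and> f 0 = 0}"

(* All complex powers are the principal ones.  Since 0 powr a = 0, the kernel R takes its
   limiting value 0 at \<zeta> = 1 when Re \<nu> < 0. *)

definition kernel_R :: "complex \<Rightarrow> complex \<Rightarrow> real \<Rightarrow> complex" where
  "kernel_R x \<nu> \<zeta> =
     x * (1 - of_real \<zeta>) powr (- \<nu>) * (1 - (1 - x) * of_real \<zeta>) powr (\<nu> - 1)"

definition coeff_c :: "complex \<Rightarrow> complex \<Rightarrow> complex" where
  "coeff_c x \<nu> = (1 - \<nu> * x) / (1 - x)"

definition op_L :: "complex \<Rightarrow> complex \<Rightarrow> (complex \<Rightarrow> complex) \<Rightarrow> complex \<Rightarrow> complex" where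
  "op_L x \<nu> f z = integral {0..1} (\<lambda>\<zeta>.
     ((1 + z * kernel_R x \<nu> \<zeta>) * f (of_real \<zeta> * kernel_R x \<nu> \<zeta> * z)
       - coeff_c x \<nu> * z * kernel_R x \<nu> \<zeta> * deriv f (of_real \<zeta> * kernel_R x \<nu> \<zeta> * z))
     * exp (- kernel_R x \<nu> \<zeta> * z))"

(* The contours denoted by an integral from 0 to (1+): off its base point 0 the loop avoids the
   cut (-\<infinity>, 1], so that t and t - 1 stay off the branch cut of the principal logarithm. *)

definition loop_around_1 :: "(real \<Rightarrow> complex) \<Rightarrow> bool" where
  "loop_around_1 \<gamma> \<longleftrightarrow>
     valid_path \<gamma> \<and> simple_path \<gamma> \<and> pathstart \<gamma> = 0 \<and> pathfinish \<gamma> = 0 \<and>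
     (\<forall>s\<in>{0<..<1}. \<gamma> s \<notin> complex_of_real ` {..1}) \<and>
     (\<forall>\<^sub>F s in at_right 0. Im (\<gamma> s) < 0) \<and>
     (\<forall>\<^sub>F s in at_left 1. Im (\<gamma> s) > 0) \<and>
     winding_number \<gamma> 1 = 1"

(* At the base point t = 0 of the loop this integrand has the value 0 (division by zero), which
   for K in H0 and Re \<nu> < 0 is also its limit along the loop. *)

definition loop_integrand ::
  "complex \<Rightarrow> complex \<Rightarrow> (complex \<Rightarrow> complex) \<Rightarrow> complex \<Rightarrow> complex \<Rightarrow> complex" where
  "loop_integrand x \<nu> K z t =
     exp (x * t * z) / (t * (1 - t)) * K (z * t powr (1 - \<nu>) * (t - 1) powr \<nu>)"

definition line_integrand ::
  "complex \<Rightarrow> complex \<Rightarrow> (complex \<Rightarrow> complex) \<Rightarrow> complex \<Rightarrow> complex \<Rightarrow> complex" where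
  "line_integrand x \<nu> K z r =
     exp (x * z / r) / (r - 1) * K (z * (1 - r) powr \<nu> / r)"

(* Integration along the upwards oriented line Re r = c, parametrised by r = c + i s, dr = i ds. *)

definition vertical_integrable :: "real \<Rightarrow> (complex \<Rightarrow> complex) \<Rightarrow> bool" where
  "vertical_integrable c F \<longleftrightarrow> integrable lborel (\<lambda>s. F (Complex c s))"

definition vertical_integral :: "real \<Rightarrow> (complex \<Rightarrow> complex) \<Rightarrow> complex" where
  "vertical_integral c F = \<i> * (LINT s|lborel. F (Complex c s))"

end

theory Submission imports Defs begin

text \<open>
  Why the inversion formulas hold. For $f \in \mathscr{H}_0$ put $g(u) = e^{-(1-x)u} f(u)$ (the
  \<^emph>\<open>twist\<close> of $f$). Up to the derivative of the function $(1-\zeta) e^{-\mathfrak{R}(\zeta) z} f(\zeta \mathfrak{R}(\zeta) z)$,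
  which vanishes at both ends of $[0,1]$, the integrand of $\mathfrak{L} f$ is a multiple of
  $(\mathfrak{R}/q)\, g'(\zeta\mathfrak{R} z)\, e^{-q \mathfrak{R} z}$ with $q = 1 - (1-x)\zeta$
  (\<open>op_L_eq_integral_deriv_twist\<close>). So $\mathfrak{L}$ acts on the Taylor coefficients of $g$ by a
  lower triangular matrix, and its entries are elementary: with $r = x\zeta/q$ the moments of the
  kernel become Beta integrals $\int_0^1 r^{i} (1-r)^{a}\,dr$ with an integer $i$
  (\<open>kernel_moment\<close>, \<open>op_L_power_series\<close>). The diagonal is nonzero, hence $\mathfrak{L}$ is
  injective (\<open>op_L_inj_on\<close>).

  The proposed inverse is, after the same twist, an integral of
  $e^{xz/r} K(z(1-r)^\nu/r)/(r-1)$. Powers of $(1-r)^\nu/r$ and of $1/r$ multiply to an integer power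
  of $1/r$ times a function that is holomorphic near $0$, so over a small circle about $0$ the
  integral is an entire function of $z$ whose Taylor coefficients are finite sums with binomial coefficients
  (\<open>circle_integral_power_series\<close>). That the two triangular matrices are inverse to each other is an
  alternating sum of quotients of Pochhammer symbols, and this sum telescopes
  (\<open>alternating_pochhammer_sum\<close>, \<open>op_L_inverse_L\<close>).

  It remains to move the contour. The integrand decays like $|r|^{-2}$, so the vertical line can be
  closed to the left and the residue theorem in the half-plane $\mathrm{Re}\, r < 1$ gives the
  circle (\<open>line_integral_eq_circle_integral\<close>). Under $t = 1/r$ the line becomes a curve from $0$ to
  $0$ in the plane slit along $(-\infty,1]$. There the loop integrand has a primitive with one limit
  at $0$ from the upper and one from the lower half-plane, and the integral along every admissible
  loop is the difference of these two limits, as is the integral along the line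
  (\<open>loop_integral_eq_vertical_integral\<close>).
\<close>

section \<open>Power series with infinite radius of convergence\<close>

lemma power_series_coeffs_unique:
  fixes a b :: "nat \<Rightarrow> complex"
  assumes "\<And>z. (\<lambda>n. a n * z ^ n) sums F z" "\<And>z. (\<lambda>n. b n * z ^ n) sums F z"
  shows "a = b"
proof (rule ccontr)
  assume "a \<noteq> b"
  define c where "c n = a n - b n" for n
  have c: "(\<lambda>n. c n * z ^ n) sums 0" for z
    using sums_diff[OF assms(1)[of z] assms(2)[of z]] by (simp add: c_def algebra_simps)
  obtain m where m: "c m \<noteq> 0"
    using \<open>a \<noteq> b\<close> by (auto simp: c_def fun_eq_iff)
  have "m > 0" using c[of 0] m by (cases m) auto
  show False
  proof (rule powser_0_nonzero[of 1 0 c "\<lambda>_. 0" m])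
    fix s :: real
    assume s: "0 < s" "\<And>z :: complex. z \<in> cball 0 s - {0} \<Longrightarrow> (0 :: complex) \<noteq> 0"
    from s(2)[of "of_real s"] s(1) show False by simp
  qed (use c m \<open>m > 0\<close> in auto)
qed

definition taylor_coeff :: "(complex \<Rightarrow> complex) \<Rightarrow> nat \<Rightarrow> complex" where
  "taylor_coeff f n = (deriv ^^ n) f 0 / fact n"

lemma taylor_coeff_sums:
  assumes "f holomorphic_on UNIV"
  shows "(\<lambda>n. taylor_coeff f n * z ^ n) sums f z"
  using holomorphic_power_series[of f 0 "norm z + 1" z] holomorphic_on_subset[OF assms]
  by (simp add: taylor_coeff_def)

lemma taylor_coeff_0: "taylor_coeff f 0 = f 0"
  by (simp add: taylor_coeff_def)

lemma everywhere_summable_norm: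
  fixes a :: "nat \<Rightarrow> complex"
  assumes "\<And>z. summable (\<lambda>n. a n * z ^ n)"
  shows "summable (\<lambda>n. norm (a n) * r ^ n)"
proof -
  have "summable (\<lambda>n. norm (a n * (of_real \<bar>r\<bar>) ^ n))"
    by (rule powser_insidea[OF assms, of _ "of_real (\<bar>r\<bar> + 1)"]) auto
  then have "summable (\<lambda>n. norm (norm (a n) * r ^ n))"
    by (simp add: norm_mult norm_power power_abs abs_mult)
  then show ?thesis by (rule summable_norm_cancel)
qed

text \<open>
  The common tool for both kernels: an integral over a compact parameter interval of
  $\varphi F(\alpha z) G(\beta z)$, with $F$ and $G$ entire, may be expanded in $z$ termwise. The
  Cauchy product of the majorants of $F$ and $G$ dominates the terms uniformly in the parameter, so
  the Weierstrass test applies.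
\<close>

lemma integral_product_power_series:
  fixes a b :: "nat \<Rightarrow> complex" and \<phi> \<alpha> \<beta> :: "real \<Rightarrow> complex"
  assumes a: "\<And>z. (\<lambda>n. a n * z ^ n) sums F z" and b: "\<And>z. (\<lambda>n. b n * z ^ n) sums G z"
    and cont: "continuous_on {0..1} \<phi>" "continuous_on {0..1} \<alpha>" "continuous_on {0..1} \<beta>"
  shows "(\<lambda>p. (\<Sum>i\<le>p. a i * b (p - i) * integral {0..1} (\<lambda>s. \<phi> s * \<alpha> s ^ i * \<beta> s ^ (p - i))) * z ^ p)
           sums integral {0..1} (\<lambda>s. \<phi> s * F (\<alpha> s * z) * G (\<beta> s * z))"
proof -
  define T where "T p s = \<phi> s * (\<Sum>i\<le>p. (a i * (\<alpha> s * z) ^ i) * (b (p - i) * (\<beta> s * z) ^ (p - i)))"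
    for p s
  have bdd: "\<exists>B\<ge>0. \<forall>s\<in>{0..1}. norm (h s) \<le> B" if "continuous_on {0..1} h" for h :: "real \<Rightarrow> complex"
  proof -
    have "bounded (h ` {0..1})"
      using that by (intro compact_imp_bounded compact_continuous_image) auto
    then obtain B where "\<forall>y\<in>h ` {0..1}. norm y \<le> B" by (auto simp: bounded_iff)
    then show ?thesis by (intro exI[of _ "max B 0"]) (auto simp: le_max_iff_disj)
  qed
  obtain B\<phi> where B\<phi>: "B\<phi> \<ge> 0" "\<And>s. s \<in> {0..1} \<Longrightarrow> norm (\<phi> s) \<le> B\<phi>"
    using bdd[OF cont(1)] by blast
  obtain B\<alpha> where B\<alpha>: "B\<alpha> \<ge> 0" "\<And>s. s \<in> {0..1} \<Longrightarrow> norm (\<alpha> s) \<le> B\<alpha>"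
    using bdd[OF cont(2)] by blast
  obtain B\<beta> where B\<beta>: "B\<beta> \<ge> 0" "\<And>s. s \<in> {0..1} \<Longrightarrow> norm (\<beta> s) \<le> B\<beta>"
    using bdd[OF cont(3)] by blast
  have sa: "summable (\<lambda>n. norm (a n) * r ^ n)" and sb: "summable (\<lambda>n. norm (b n) * r ^ n)" for r
    by (rule everywhere_summable_norm, rule sums_summable, rule a,
        rule everywhere_summable_norm, rule sums_summable, rule b)
  define M where "M p = B\<phi> * (\<Sum>i\<le>p. (norm (a i) * (B\<alpha> * norm z) ^ i) *
     (norm (b (p - i)) * (B\<beta> * norm z) ^ (p - i)))" for p
  have "summable M"
    unfolding M_def using sa[of "B\<alpha> * norm z"] sb[of "B\<beta> * norm z"] B\<alpha>(1) B\<beta>(1)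
    by (intro summable_mult summable_Cauchy_product) (simp_all add: abs_mult)
  have TM: "norm (T p s) \<le> M p" if "s \<in> {0..1}" for p s
  proof -
    have "norm (\<Sum>i\<le>p. (a i * (\<alpha> s * z) ^ i) * (b (p - i) * (\<beta> s * z) ^ (p - i)))
        \<le> (\<Sum>i\<le>p. (norm (a i) * (B\<alpha> * norm z) ^ i) * (norm (b (p - i)) * (B\<beta> * norm z) ^ (p - i)))"
      using B\<alpha>(2)[OF that] B\<beta>(2)[OF that] B\<alpha>(1) B\<beta>(1)
      by (intro sum_norm_le) (auto simp: norm_mult norm_power intro!: mult_mono power_mono)
    then show ?thesis
      unfolding T_def M_def norm_mult using B\<phi>(2)[OF that] B\<phi>(1) by (intro mult_mono) auto
  qed
  have Tsum: "(\<lambda>p. T p s) sums (\<phi> s * F (\<alpha> s * z) * G (\<beta> s * z))" for s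
  proof -
    have "summable (\<lambda>n. norm (a n * (\<alpha> s * z) ^ n))" "summable (\<lambda>n. norm (b n * (\<beta> s * z) ^ n))"
      using sa[of "norm (\<alpha> s * z)"] sb[of "norm (\<beta> s * z)"] by (simp_all add: norm_mult norm_power)
    from Cauchy_product_sums[OF this] have
      "(\<lambda>p. \<Sum>i\<le>p. (a i * (\<alpha> s * z) ^ i) * (b (p - i) * (\<beta> s * z) ^ (p - i)))
         sums (F (\<alpha> s * z) * G (\<beta> s * z))"
      using a b by (simp add: sums_iff)
    then show ?thesis unfolding T_def mult.assoc by (rule sums_mult)
  qed
  have unif: "uniform_limit {0..1} (\<lambda>n s. \<Sum>p<n. T p s)
                (\<lambda>s. \<phi> s * F (\<alpha> s * z) * G (\<beta> s * z)) sequentially"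
  proof -
    have "uniform_limit {0..1} (\<lambda>n s. \<Sum>p<n. T p s) (\<lambda>s. suminf (\<lambda>p. T p s)) sequentially"
      by (rule Weierstrass_m_test[OF _ \<open>summable M\<close>]) (use TM in auto)
    then show ?thesis using Tsum by (simp add: sums_iff)
  qed
  have Tcont: "continuous_on {0..1} (T p)" for p
    unfolding T_def by (intro continuous_intros cont)
  have Sint: "((\<lambda>s. \<Sum>p<n. T p s) has_integral (\<Sum>p<n. integral {0..1} (T p))) {0..1}" for n
    by (intro has_integral_sum integrable_integral integrable_continuous_interval Tcont) auto
  have TI: "integral {0..1} (T p) =
     (\<Sum>i\<le>p. a i * b (p - i) * integral {0..1} (\<lambda>s. \<phi> s * \<alpha> s ^ i * \<beta> s ^ (p - i))) * z ^ p" for p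
  proof -
    have "T p = (\<lambda>s. \<Sum>i\<le>p. (a i * b (p - i) * z ^ p) * (\<phi> s * \<alpha> s ^ i * \<beta> s ^ (p - i)))"
    proof
      fix s
      have "z ^ p = z ^ i * z ^ (p - i)" if "i \<le> p" for i
        using that by (simp flip: power_add)
      then show "T p s = (\<Sum>i\<le>p. (a i * b (p - i) * z ^ p) * (\<phi> s * \<alpha> s ^ i * \<beta> s ^ (p - i)))"
        unfolding T_def sum_distrib_left
        by (intro sum.cong) (auto simp: power_mult_distrib)
    qed
    then have "integral {0..1} (T p) = (\<Sum>i\<le>p. integral {0..1}
       (\<lambda>s. (a i * b (p - i) * z ^ p) * (\<phi> s * \<alpha> s ^ i * \<beta> s ^ (p - i))))"
      by (simp only:, intro integral_sum)
        (auto intro!: integrable_continuous_interval continuous_intros cont)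
    also have "\<dots> = (\<Sum>i\<le>p. a i * b (p - i) * integral {0..1} (\<lambda>s. \<phi> s * \<alpha> s ^ i * \<beta> s ^ (p - i))) * z ^ p"
      by (simp only: integral_mult_right sum_distrib_right) (simp add: mult_ac)
    finally show ?thesis .
  qed
  have "(\<lambda>n. \<Sum>p<n. integral {0..1} (T p)) \<longlonglongrightarrow>
           integral {0..1} (\<lambda>s. \<phi> s * F (\<alpha> s * z) * G (\<beta> s * z))"
  proof -
    obtain I J where I: "\<And>n. ((\<lambda>s. \<Sum>p<n. T p s) has_integral I n) {0..1}"
      and J: "((\<lambda>s. \<phi> s * F (\<alpha> s * z) * G (\<beta> s * z)) has_integral J) {0..1}"
      and lim: "I \<longlonglongrightarrow> J"
    proof (rule uniform_limit_integral[OF unif])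
      show "continuous_on {0..1} (\<lambda>s. \<Sum>p<n. T p s)" for n
        by (intro continuous_intros Tcont)
    qed auto
    have "I = (\<lambda>n. \<Sum>p<n. integral {0..1} (T p))"
      using has_integral_unique[OF I Sint] by auto
    then show ?thesis using lim integral_unique[OF J] by simp
  qed
  then show ?thesis by (simp add: sums_def TI)
qed

section \<open>An alternating sum of Pochhammer quotients\<close>

lemma pochhammer_ne_0_of_Re_pos:
  fixes a :: complex
  assumes "Re a > 0"
  shows "pochhammer a n \<noteq> 0"
proof (induction n)
  case (Suc n)
  have "Re (a + of_nat n) > 0" using assms by simp
  then have "a + of_nat n \<noteq> 0" by (metis less_irrefl zero_complex.sel(1))
  with Suc show ?case by (simp add: pochhammer_Suc)
qed simp

text \<open>
  Keeps all Pochhammer symbols that occur in denominators away from zero.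
\<close>

lemma Re_shift_pos:
  assumes "Re \<nu> < 0"
  shows "Re (1 - of_nat p * \<nu>) > 0"
proof -
  have "real p * Re \<nu> \<le> 0" using assms by (intro mult_nonneg_nonpos) auto
  then show ?thesis by simp
qed

text \<open>
  Gosper summation: the right-hand side is the antidifference of the summand. The induction step
  reduces to the relation $(J+1)\binom{N}{J+1} = (N-J)\binom{N}{J}$.
\<close>

lemma alternating_pochhammer_sum_partial:
  fixes \<nu> :: complex and m N :: nat
  assumes "Re \<nu> < 0" "m > 0"
  defines "a \<equiv> 1 - of_nat m * \<nu>" and "b \<equiv> 1 - of_nat (m + Suc N) * \<nu>"
  shows "(1 - \<nu>) * (\<Sum>j\<le>J. (-1) ^ j * of_nat (Suc N choose j) * of_nat (m + j) *
           pochhammer a (m + j - 1) / pochhammer b (m + j)) =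
         (-1) ^ J * of_nat (N choose J) * pochhammer a (m + J) / pochhammer b (m + J)"
proof (induction J)
  case 0
  obtain k where k: "m = Suc k" using \<open>m > 0\<close> by (cases m) auto
  have "pochhammer a m = pochhammer a k * (of_nat m * (1 - \<nu>))"
    by (simp add: k pochhammer_Suc a_def algebra_simps)
  then show ?case by (simp add: k)
next
  case (Suc J)
  define n :: complex where "n = of_nat (m + Suc J)"
  define A B :: complex where "A = of_nat (N choose J)" and "B = of_nat (N choose Suc J)"
  define P Q where "P = pochhammer a (m + J)" and "Q = pochhammer b (m + J)"
  have b: "Re b > 0" unfolding b_def by (rule Re_shift_pos) fact
  have Q: "Q \<noteq> 0" unfolding Q_def by (rule pochhammer_ne_0_of_Re_pos) (rule b)
  have P': "pochhammer a (m + Suc J) = P * (n - of_nat m * \<nu>)"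
    by (simp add: P_def pochhammer_Suc a_def n_def algebra_simps)
  have Q': "pochhammer b (m + Suc J) = Q * (n - of_nat (m + Suc N) * \<nu>)"
    by (simp add: Q_def pochhammer_Suc b_def n_def algebra_simps)
  define d where "d = n - of_nat (m + Suc N) * \<nu>"
  have d: "d \<noteq> 0"
    using pochhammer_ne_0_of_Re_pos[OF b, of "m + Suc J"] unfolding Q' d_def by auto
  have AB: "of_nat (Suc J) * B = (of_nat N - of_nat J) * A"
  proof (cases "J \<le> N")
    case True
    have "Suc J * (N choose Suc J) = (N - J) * (N choose J)"
      using True by (metis Suc_times_binomial_add add.commute binomial_absorb_comp binomial_absorption mult.commute)
    then have "complex_of_nat (Suc J * (N choose Suc J)) = of_nat ((N - J) * (N choose J))" by (rule arg_cong)
    then show ?thesis unfolding A_def B_def of_nat_mult using True by (simp add: of_nat_diff)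
  qed (auto simp: A_def B_def binomial_eq_0)
  have key: "A * d - (1 - \<nu>) * (A + B) * n = - B * (n - of_nat m * \<nu>)"
  proof -
    have "A * d - (1 - \<nu>) * (A + B) * n + B * (n - of_nat m * \<nu>) =
       \<nu> * (of_nat (Suc J) * B - (of_nat N - of_nat J) * A)"
      by (simp add: d_def n_def algebra_simps)
    then show ?thesis unfolding AB by (simp add: algebra_simps)
  qed
  have binomial_sum: "of_nat (Suc N choose Suc J) = A + B" by (simp add: A_def B_def)
  have idx: "m + Suc J - 1 = m + J" by simp
  have "(1 - \<nu>) * (\<Sum>j\<le>Suc J. (-1) ^ j * of_nat (Suc N choose j) * of_nat (m + j) *
           pochhammer a (m + j - 1) / pochhammer b (m + j))
      = (-1) ^ J * A * P / Q + (1 - \<nu>) * ((-1) ^ Suc J * (A + B) * n * P / (Q * d))"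
    unfolding sum.atMost_Suc distrib_left Suc.IH Q' d_def[symmetric] binomial_sum idx
      n_def[symmetric] A_def[symmetric] P_def[symmetric] Q_def[symmetric]
    by (rule refl)
  also have "\<dots> = (-1) ^ J * P / (Q * d) * (A * d - (1 - \<nu>) * (A + B) * n)"
    using Q d by (simp add: divide_simps) (simp add: algebra_simps)
  also have "\<dots> = (-1) ^ Suc J * B * (P * (n - of_nat m * \<nu>)) / (Q * d)"
    unfolding key by simp
  finally show ?case unfolding P' Q' d_def[symmetric] B_def by simp
qed

text \<open>
  The off-diagonal vanishing and the diagonal value that make the two triangular matrices inverse
  to each other: for $N > 0$ the closed form of the partial sum contains the factor
  $\binom{N-1}{N} = 0$.
\<close>

lemma alternating_pochhammer_sum:
  fixes \<nu> :: complex
  assumes "Re \<nu> < 0" "m > 0"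
  shows "(1 - \<nu>) * (\<Sum>j\<le>N. (-1) ^ j * of_nat (N choose j) * of_nat (m + j) *
           pochhammer (1 - of_nat m * \<nu>) (m + j - 1) / pochhammer (1 - of_nat (m + N) * \<nu>) (m + j)) =
         (if N = 0 then 1 else 0)"
proof (cases N)
  case 0
  obtain k where k: "m = Suc k" using \<open>m > 0\<close> by (cases m) auto
  have "pochhammer (1 - of_nat m * \<nu>) m = pochhammer (1 - of_nat m * \<nu>) k * (of_nat m * (1 - \<nu>))"
    by (simp add: k pochhammer_Suc algebra_simps)
  moreover have "pochhammer (1 - of_nat m * \<nu>) m \<noteq> 0"
    by (rule pochhammer_ne_0_of_Re_pos, rule Re_shift_pos) fact
  ultimately show ?thesis using 0 by (simp add: k)
next
  case (Suc N')
  show ?thesis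
    unfolding Suc using alternating_pochhammer_sum_partial[OF assms, of N' "Suc N'"] by simp
qed

section \<open>Beta integrals along the parameter interval\<close>

locale inversion_kernel =
  fixes x \<nu> :: complex
  assumes x_notin: "x \<notin> \<real>\<^sub>\<le>\<^sub>0" and x_ne_1: "x \<noteq> 1" and Re_nu: "Re \<nu> < 0"
begin

abbreviation q :: "complex \<Rightarrow> complex" where "q \<zeta> \<equiv> 1 - (1 - x) * \<zeta>"

lemma x_ne_0: "x \<noteq> 0" using x_notin by auto

text \<open>
  The point $q(\zeta) = (1-\zeta)\cdot 1 + \zeta\cdot x$ lies on the segment from $1$ to $x$, which avoids the
  branch cut because $x$ does.
\<close>

lemma q_notin:
  assumes "\<zeta> \<in> {0..1}"
  shows "q (of_real \<zeta>) \<notin> \<real>\<^sub>\<le>\<^sub>0"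
proof
  assume "q (of_real \<zeta>) \<in> \<real>\<^sub>\<le>\<^sub>0"
  then have re: "1 - \<zeta> + \<zeta> * Re x \<le> 0" and im: "\<zeta> * Im x = 0"
    by (auto simp: complex_nonpos_Reals_iff algebra_simps)
  have "\<zeta> > 0" using re assms by (cases "\<zeta> = 0") auto
  then have "\<zeta> * Re x \<le> 0" using re assms by auto
  with \<open>\<zeta> > 0\<close> have "Re x \<le> 0" by (simp add: mult_le_0_iff)
  with im \<open>\<zeta> > 0\<close> x_notin show False by (simp add: complex_nonpos_Reals_iff)
qed

lemma q_ne_0: "\<zeta> \<in> {0..1} \<Longrightarrow> q (of_real \<zeta>) \<noteq> 0"
  using q_notin[of \<zeta>] by auto

lemma continuous_on_one_minus_powr [continuous_intros]:
  assumes "Re a > 0"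
  shows "continuous_on {0..1} (\<lambda>\<zeta>. (1 - complex_of_real \<zeta>) powr a)"
  by (rule continuous_on_powr_complex) (use assms in \<open>auto intro!: continuous_intros\<close>)

lemma continuous_on_q_powr [continuous_intros]:
  "continuous_on {0..1} (\<lambda>\<zeta>. q (of_real \<zeta>) powr a)"
proof -
  have "((\<lambda>\<zeta>. q (of_real \<zeta>) powr a) \<longlongrightarrow> q (of_real s) powr a) (at s within {0..1})"
    if "s \<in> {0..1}" for s
    by (intro tendsto_powr_complex tendsto_intros q_notin that)
  then show ?thesis by (simp add: continuous_on_def)
qed

lemma one_minus_notin: "\<zeta> < 1 \<Longrightarrow> 1 - complex_of_real \<zeta> \<notin> \<real>\<^sub>\<le>\<^sub>0"
  by (simp add: complex_nonpos_Reals_iff)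

text \<open>
  In the variable $r = x\zeta/q$ this is, up to a power of $x$, the Beta integrand
  $r^n(1-r)^a\,dr$, because $1 - r = (1-\zeta)/q$ and $dr = x\,d\zeta/q^2$. Staying in the variable $\zeta$
  avoids a contour deformation, since $r$ runs from $0$ to $1$
  along a circular arc in general.
\<close>

definition beta_weight :: "complex \<Rightarrow> nat \<Rightarrow> real \<Rightarrow> complex" where
  "beta_weight a n \<zeta> = (1 - of_real \<zeta>) powr a * of_real \<zeta> ^ n * q (of_real \<zeta>) powr (- a - of_nat n - 2)"

lemma continuous_on_beta_weight:
  "Re a > 0 \<Longrightarrow> continuous_on {0..1} (beta_weight a n)"
  unfolding beta_weight_def by (intro continuous_intros)

text \<open>
  The derivative of $r^n(1-r)^{a+1}$, pulled back to $\zeta$; its boundary values at $0$ and $1$ vanish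
  unless $n = 0$.
\<close>

lemma beta_weight_recursion:
  assumes a: "Re a > 0"
  shows "((\<lambda>\<zeta>. of_nat n * beta_weight a (n - 1) \<zeta> - (of_nat n + 1 + a) * x * beta_weight a n \<zeta>)
           has_integral (if n = 0 then -1 else 0)) {0..1}"
proof -
  define V where "V \<zeta> = (1 - \<zeta>) powr (a + 1) * \<zeta> ^ n * q \<zeta> powr (- a - 1 - of_nat n)" for \<zeta>
  define V' where "V' \<zeta> = of_nat n * beta_weight a (n - 1) \<zeta> - (of_nat n + 1 + a) * x * beta_weight a n \<zeta>" for \<zeta>
  have "(V has_field_derivative V' \<zeta>) (at (of_real \<zeta>))" if \<zeta>: "\<zeta> \<in> {0<..<1}" for \<zeta>
  proof -
    let ?z = "complex_of_real \<zeta>"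
    have nin: "1 - ?z \<notin> \<real>\<^sub>\<le>\<^sub>0" "q ?z \<notin> \<real>\<^sub>\<le>\<^sub>0"
      using \<zeta> by (auto intro!: q_notin one_minus_notin)
    then have ne: "1 - ?z \<noteq> 0" "q ?z \<noteq> 0" by auto
    define A Q where "A = (1 - ?z) powr a" and "Q = q ?z powr (- a - of_nat n - 2)"
    have 1: "(1 - ?z) powr (a + 1) = A * (1 - ?z)"
      using ne by (simp add: A_def powr_add)
    have "q ?z powr (- a - of_nat n - 2 + 1) = Q * q ?z"
      unfolding powr_add Q_def using ne by simp
    moreover have "- a - of_nat n - 2 + 1 = - a - 1 - of_nat n" by simp
    ultimately have 2: "q ?z powr (- a - 1 - of_nat n) = Q * q ?z" by simp
    have 3: "q ?z powr (- a - 1 - of_nat n - 1) = Q" by (simp add: Q_def algebra_simps)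
    have 4: "of_nat n * beta_weight a (n - 1) \<zeta> = of_nat n * A * ?z ^ (n - 1) * (Q * q ?z)"
    proof (cases n)
      case (Suc k)
      have "- a - of_nat k - 2 = - a - 1 - of_nat (Suc k)" by simp
      then have "beta_weight a k \<zeta> = A * ?z ^ k * (Q * q ?z)"
        using 2 unfolding beta_weight_def A_def Suc by simp
      then show ?thesis by (simp add: Suc)
    qed simp
    have 5: "beta_weight a n \<zeta> = A * ?z ^ n * Q" by (simp add: beta_weight_def A_def Q_def)
    have "(V has_field_derivative
       (- (a + 1) * (1 - ?z) powr a * ?z ^ n * q ?z powr (- a - 1 - of_nat n)
        + (1 - ?z) powr (a + 1) * (of_nat n * ?z ^ (n - 1)) * q ?z powr (- a - 1 - of_nat n)
        + (1 - ?z) powr (a + 1) * ?z ^ n *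
           ((a + 1 + of_nat n) * (1 - x) * q ?z powr (- a - 1 - of_nat n - 1)))) (at ?z)"
      unfolding V_def
      by (rule derivative_eq_intros refl nin | simp)+ (simp add: algebra_simps)
    also have "(- (a + 1) * (1 - ?z) powr a * ?z ^ n * q ?z powr (- a - 1 - of_nat n)
        + (1 - ?z) powr (a + 1) * (of_nat n * ?z ^ (n - 1)) * q ?z powr (- a - 1 - of_nat n)
        + (1 - ?z) powr (a + 1) * ?z ^ n *
           ((a + 1 + of_nat n) * (1 - x) * q ?z powr (- a - 1 - of_nat n - 1))) = V' \<zeta>"
      unfolding 1 2 3 V'_def 4 5 A_def[symmetric]
      by (cases n) (simp_all add: algebra_simps)
    finally show ?thesis .
  qed
  then have der: "((\<lambda>\<zeta>. V (of_real \<zeta>)) has_vector_derivative V' \<zeta>) (at \<zeta>)" if "\<zeta> \<in> {0<..<1}" for \<zeta>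
    using that by (intro has_vector_derivative_real_field)
  have "continuous_on {0..1} (\<lambda>\<zeta>. V (of_real \<zeta>))"
    unfolding V_def using a by (intro continuous_intros) auto
  from fundamental_theorem_of_calculus_interior[OF _ this der]
  have "(V' has_integral (V 1 - V 0)) {0..1}" by simp
  moreover have "V 1 - V 0 = (if n = 0 then -1 else 0)"
    by (auto simp: V_def)
  ultimately show ?thesis by (simp add: V'_def[abs_def])
qed

lemma integral_beta_weight:
  assumes a: "Re a > 0"
  shows "integral {0..1} (beta_weight a n) = fact n / (x ^ Suc n * pochhammer (1 + a) (Suc n))"
proof (induction n)
  case 0
  have int: "beta_weight a 0 integrable_on {0..1}"
    by (intro integrable_continuous_interval continuous_on_beta_weight a)
  have "((\<lambda>\<zeta>. - ((1 + a) * x * beta_weight a 0 \<zeta>)) has_integral -1) {0..1}"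
    using beta_weight_recursion[OF a, of 0] by simp
  moreover have "((\<lambda>\<zeta>. - ((1 + a) * x * beta_weight a 0 \<zeta>)) has_integral
      - ((1 + a) * x * integral {0..1} (beta_weight a 0))) {0..1}"
    by (intro has_integral_neg has_integral_mult_right integrable_integral int)
  ultimately have eq: "- ((1 + a) * x * integral {0..1} (beta_weight a 0)) = -1"
    using has_integral_unique by blast
  have "pochhammer (1 + a) 1 \<noteq> 0"
    by (rule pochhammer_ne_0_of_Re_pos) (use a in simp)
  then have "x * (1 + a) \<noteq> 0" using x_ne_0 by simp
  moreover have "(x * (1 + a)) * integral {0..1} (beta_weight a 0) = 1"
    using eq by (simp add: algebra_simps)
  ultimately show ?case by (simp add: eq_divide_eq mult.commute)
next
  case (Suc n)
  have int: "beta_weight a k integrable_on {0..1}" for k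
    by (intro integrable_continuous_interval continuous_on_beta_weight a)
  let ?I = "\<lambda>k. integral {0..1} (beta_weight a k)"
  have "((\<lambda>\<zeta>. of_nat (Suc n) * beta_weight a n \<zeta> - (of_nat (Suc n) + 1 + a) * x * beta_weight a (Suc n) \<zeta>)
           has_integral (of_nat (Suc n) * ?I n - (of_nat (Suc n) + 1 + a) * x * ?I (Suc n))) {0..1}"
    by (intro has_integral_diff has_integral_mult_right integrable_integral int)
  from has_integral_unique[OF this beta_weight_recursion[OF a, of "Suc n", simplified diff_Suc_1]]
  have eq: "(1 + a + of_nat (Suc n)) * x * ?I (Suc n) = of_nat (Suc n) * ?I n"
    by (simp add: algebra_simps)
  have nz: "pochhammer (1 + a) (Suc (Suc n)) \<noteq> 0" "pochhammer (1 + a) (Suc n) \<noteq> 0"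
    by (rule pochhammer_ne_0_of_Re_pos, use a in simp)+
  then have "1 + a + of_nat (Suc n) \<noteq> 0" unfolding pochhammer_Suc[of _ "Suc n"] by auto
  then have "(1 + a + of_nat (Suc n)) * x \<noteq> 0" using x_ne_0 by simp
  moreover have "?I (Suc n) * ((1 + a + of_nat (Suc n)) * x) = of_nat (Suc n) * ?I n"
    using eq by (simp only: mult_ac)
  ultimately have "?I (Suc n) = of_nat (Suc n) * ?I n / ((1 + a + of_nat (Suc n)) * x)"
    by (rule nonzero_eq_divide_eq[THEN iffD2])
  also have "\<dots> = fact (Suc n) / (x ^ Suc (Suc n) * pochhammer (1 + a) (Suc (Suc n)))"
    unfolding Suc.IH pochhammer_Suc[of _ "Suc n"] by simp
  finally show ?case .
qed

end

section \<open>The operator in terms of the twisted function\<close>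

context inversion_kernel
begin

abbreviation R :: "real \<Rightarrow> complex" where "R \<equiv> kernel_R x \<nu>"

text \<open>
  The scalar that the integration by parts in \<open>op_L_eq_integral_deriv_twist\<close> leaves in front.
\<close>

definition \<kappa> :: complex where "\<kappa> = - (x * (1 - \<nu>) / (1 - x))"

lemma continuous_on_R: "continuous_on {0..1} R"
  unfolding kernel_R_def using Re_nu by (intro continuous_intros) simp

lemma continuous_on_R_over_q: "continuous_on {0..1} (\<lambda>\<zeta>. R \<zeta> / q (of_real \<zeta>))"
  by (intro continuous_intros continuous_on_R) (use q_ne_0 in auto)

text \<open>
  The exponential is chosen so that $f' - (1-x) f$ becomes a total derivative.
\<close>

definition twist :: "(complex \<Rightarrow> complex) \<Rightarrow> complex \<Rightarrow> complex" where
  "twist f u = exp (- (1 - x) * u) * f u"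

lemma deriv_twist:
  assumes "f holomorphic_on UNIV"
  shows "deriv (twist f) u = exp (- (1 - x) * u) * (deriv f u - (1 - x) * f u)"
proof -
  have "(f has_field_derivative deriv f u) (at u)"
    using assms holomorphic_derivI[of f UNIV u] by simp
  then have "(twist f has_field_derivative
      (exp (- (1 - x) * u) * (deriv f u - (1 - x) * f u))) (at u)"
    unfolding twist_def by (auto intro!: derivative_eq_intros simp: algebra_simps)
  then show ?thesis by (rule DERIV_imp_deriv)
qed

text \<open>
  Integration by parts that removes the coefficient $c$: the difference of the two integrands is the
  derivative of $(1-\zeta) e^{-\mathfrak{R} z} f(\zeta\mathfrak{R}z)$. This function vanishes at $\zeta = 0$ because
  $f(0) = 0$. The value of $c$ is exactly the one for which $f$ and $f'$ recombine into the derivative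
  of the twist.
\<close>

lemma op_L_eq_integral_deriv_twist:
  assumes f: "f \<in> H0"
  shows "op_L x \<nu> f z = \<kappa> * z * integral {0..1} (\<lambda>\<zeta>.
     R \<zeta> / q (of_real \<zeta>) * deriv (twist f) (of_real \<zeta> * R \<zeta> * z) * exp (- (q (of_real \<zeta>) * R \<zeta>) * z))"
proof -
  have hol: "f holomorphic_on UNIV" and f0: "f 0 = 0" using f by (auto simp: H0_def)
  have hol': "deriv f holomorphic_on UNIV" using hol by (rule holomorphic_deriv) simp
  have fd: "(f has_field_derivative deriv f u) (at u)" for u
    using hol holomorphic_derivI[of f UNIV u] by simp
  have cf: "continuous_on UNIV f" "continuous_on UNIV (deriv f)"
    using hol hol' by (auto intro: holomorphic_on_imp_continuous_on)
  note cf' = cf[THEN continuous_on_compose2, OF _ subset_UNIV]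
  \<comment> \<open>the kernel as a function of a complex variable, so that it can be differentiated by the rules for \<open>has_field_derivative\<close>\<close>
  define Rc where "Rc \<zeta> = x * (1 - \<zeta>) powr (- \<nu>) * q \<zeta> powr (\<nu> - 1)" for \<zeta>
  have Rc: "Rc (of_real \<zeta>) = R \<zeta>" for \<zeta> by (simp add: Rc_def kernel_R_def)
  define j where "j \<zeta> = ((1 + z * R \<zeta>) * f (of_real \<zeta> * R \<zeta> * z)
       - coeff_c x \<nu> * z * R \<zeta> * deriv f (of_real \<zeta> * R \<zeta> * z)) * exp (- R \<zeta> * z)" for \<zeta>
  define h where "h \<zeta> = R \<zeta> / q (of_real \<zeta>) * deriv (twist f) (of_real \<zeta> * R \<zeta> * z)
      * exp (- (q (of_real \<zeta>) * R \<zeta>) * z)" for \<zeta>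
  define D where "D \<zeta> = (1 - \<zeta>) * exp (- Rc \<zeta> * z) * f (\<zeta> * Rc \<zeta> * z)" for \<zeta>
  have der: "((\<lambda>\<zeta>. D (of_real \<zeta>)) has_vector_derivative \<kappa> * z * h \<zeta> - j \<zeta>) (at \<zeta>)"
    if \<zeta>: "\<zeta> \<in> {0<..<1}" for \<zeta>
  proof -
    let ?z = "complex_of_real \<zeta>"
    have nin: "1 - ?z \<notin> \<real>\<^sub>\<le>\<^sub>0" "q ?z \<notin> \<real>\<^sub>\<le>\<^sub>0"
      using \<zeta> by (auto intro!: q_notin one_minus_notin)
    then have ne: "1 - ?z \<noteq> 0" "q ?z \<noteq> 0" by auto
    define R' where "R' = R \<zeta> * (\<nu> / (1 - ?z) + (1 - \<nu>) * (1 - x) / q ?z)"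
    have "(Rc has_field_derivative (x * ((\<nu> * (1 - ?z) powr (- \<nu> - 1)) * q ?z powr (\<nu> - 1)
       + (1 - ?z) powr (- \<nu>) * ((1 - \<nu>) * (1 - x) * q ?z powr (\<nu> - 1 - 1))))) (at ?z)"
      unfolding Rc_def
      by (rule derivative_eq_intros refl nin | simp)+ (simp add: algebra_simps)
    also have "(x * ((\<nu> * (1 - ?z) powr (- \<nu> - 1)) * q ?z powr (\<nu> - 1)
       + (1 - ?z) powr (- \<nu>) * ((1 - \<nu>) * (1 - x) * q ?z powr (\<nu> - 1 - 1)))) = R'"
    proof -
      have "(1 - ?z) powr (- \<nu> - 1) = (1 - ?z) powr (- \<nu>) / (1 - ?z)"
        "q ?z powr (\<nu> - 1 - 1) = q ?z powr (\<nu> - 1) / q ?z"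
        using ne by (subst powr_diff; simp)+
      then show ?thesis unfolding R'_def kernel_R_def
        using ne by (simp only:) (simp add: algebra_simps)
    qed
    finally have dR: "(Rc has_field_derivative R') (at ?z)" .
    define u where "u = ?z * R \<zeta> * z"
    have "(D has_field_derivative
        (- exp (- R \<zeta> * z) * f u - (1 - ?z) * (R' * z * exp (- R \<zeta> * z)) * f u
          + (1 - ?z) * exp (- R \<zeta> * z) * (deriv f u * ((R \<zeta> + ?z * R') * z)))) (at ?z)"
      unfolding D_def u_def Rc[symmetric]
      by (rule derivative_eq_intros refl dR DERIV_chain2[OF fd] | simp)+ (simp add: Rc algebra_simps)
    moreover have "- exp (- R \<zeta> * z) * f u - (1 - ?z) * (R' * z * exp (- R \<zeta> * z)) * f u
          + (1 - ?z) * exp (- R \<zeta> * z) * (deriv f u * ((R \<zeta> + ?z * R') * z)) = \<kappa> * z * h \<zeta> - j \<zeta>"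
    proof -
      define e F F' r Q where "e = exp (- R \<zeta> * z)" and "F = f u" and "F' = deriv f u"
        and "r = R \<zeta>" and "Q = q ?z"
      have Q: "Q \<noteq> 0" using ne by (simp add: Q_def)
      have "exp (- (1 - x) * u) * exp (- (q ?z * R \<zeta>) * z) = e"
        unfolding e_def exp_add[symmetric] u_def by (simp add: algebra_simps)
      then have "deriv (twist f) u * exp (- (q ?z * R \<zeta>) * z) = e * (F' - (1 - x) * F)"
        unfolding deriv_twist[OF hol] F_def F'_def by (metis mult.assoc mult.commute)
      then have h: "h \<zeta> = r / Q * (e * (F' - (1 - x) * F))"
        unfolding h_def u_def[symmetric] r_def Q_def by (simp only: mult.assoc)
      have j: "j \<zeta> = ((1 + z * r) * F - coeff_c x \<nu> * z * r * F') * e"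
        by (simp add: j_def r_def F_def F'_def e_def u_def)
      have R'1: "(1 - ?z) * R' = r * (\<nu> + (1 - \<nu>) * ((1 - x) * (1 - ?z)) / Q)"
      proof -
        have "d * (r * (\<nu> / d + (1 - \<nu>) * (1 - x) / Q)) = r * (\<nu> + (1 - \<nu>) * ((1 - x) * d) / Q)"
          if "d \<noteq> 0" for d using Q that by (simp add: field_simps)
        from this[OF ne(1)] show ?thesis by (simp add: R'_def r_def Q_def)
      qed
      have x1: "(1 - x) * (1 - ?z) = Q - x" by (simp add: Q_def algebra_simps)
      have R'2: "(1 - ?z) * R' = r * (1 - (1 - \<nu>) * x / Q)"
        unfolding R'1 x1 using Q by (simp add: field_simps)
      have k1: "\<kappa> * (1 - x) = - (x * (1 - \<nu>))" using x_ne_1 by (simp add: \<kappa>_def)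
      \<comment> \<open>the coefficients of \<open>f u\<close> and of \<open>deriv f u\<close> in the derivative of \<open>D\<close>, matched with those of \<open>h\<close> and \<open>j\<close>\<close>
      have fcoef: "- 1 - (1 - ?z) * R' * z = - \<kappa> * z * (r / Q) * (1 - x) - (1 + z * r)"
      proof -
        have eq: "- \<kappa> * z * (r / Q) * (1 - x) = - (\<kappa> * (1 - x)) * z * (r / Q)" by (simp add: mult_ac)
        show ?thesis unfolding R'2 eq k1 using Q by (simp add: field_simps)
      qed
      have fpcoef: "(1 - ?z) * r + ?z * ((1 - ?z) * R') = \<kappa> * (r / Q) + coeff_c x \<nu> * r"
      proof -
        have "(1 - x) * Q * ((1 - ?z) + ?z * (1 - (1 - \<nu>) * x / Q)) =
            (1 - x) * Q - (1 - x) * ?z * ((1 - \<nu>) * x)"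
          using Q by (simp add: field_simps)
        also have "\<dots> = - (x * (1 - \<nu>)) + (1 - \<nu> * x) * Q"
          by (simp add: Q_def algebra_simps)
        finally have "(1 - ?z) + ?z * (1 - (1 - \<nu>) * x / Q) = (- (x * (1 - \<nu>)) + (1 - \<nu> * x) * Q) / ((1 - x) * Q)"
          using Q x_ne_1 by (simp add: eq_divide_eq mult.commute)
        also have "\<dots> = \<kappa> / Q + coeff_c x \<nu>"
        proof -
          have "(B + C * Q) / (y * Q) = B / y / Q + C / y" if "y \<noteq> 0" for B C y
            using Q that by (simp add: field_simps)
          from this[of "1 - x" "- (x * (1 - \<nu>))" "1 - \<nu> * x"] x_ne_1
          show ?thesis by (simp add: \<kappa>_def coeff_c_def)
        qed
        finally have "r * ((1 - ?z) + ?z * (1 - (1 - \<nu>) * x / Q)) = r * (\<kappa> / Q + coeff_c x \<nu>)" by simp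
        then show ?thesis unfolding R'2 by (simp add: algebra_simps)
      qed
      have "- exp (- R \<zeta> * z) * f u - (1 - ?z) * (R' * z * exp (- R \<zeta> * z)) * f u
          + (1 - ?z) * exp (- R \<zeta> * z) * (deriv f u * ((R \<zeta> + ?z * R') * z))
          = e * ((- 1 - (1 - ?z) * R' * z) * F + z * F' * ((1 - ?z) * r + ?z * ((1 - ?z) * R')))"
        unfolding e_def F_def F'_def r_def
        by (simp add: algebra_simps)
      also have "\<dots> = \<kappa> * z * h \<zeta> - j \<zeta>"
      proof -
        have "e * ((- \<kappa> * z * s * (1 - x) - (1 + z * r)) * F + z * F' * (\<kappa> * s + coeff_c x \<nu> * r))
          = \<kappa> * z * (s * (e * (F' - (1 - x) * F))) - ((1 + z * r) * F - coeff_c x \<nu> * z * r * F') * e" for s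
          by (simp add: algebra_simps)
        then show ?thesis unfolding h j fcoef fpcoef .
      qed
      finally show ?thesis .
    qed
    ultimately have "(D has_field_derivative \<kappa> * z * h \<zeta> - j \<zeta>) (at ?z)" by simp
    then show ?thesis by (rule has_vector_derivative_real_field)
  qed
  have contD: "continuous_on {0..1} (\<lambda>\<zeta>. D (of_real \<zeta>))"
    unfolding D_def Rc by (intro continuous_intros continuous_on_R cf')
  have "((\<lambda>\<zeta>. \<kappa> * z * h \<zeta> - j \<zeta>) has_integral (D (of_real 1) - D (of_real 0))) {0..1}"
    by (rule fundamental_theorem_of_calculus_interior[OF _ contD der]) auto
  then have 1: "((\<lambda>\<zeta>. \<kappa> * z * h \<zeta> - j \<zeta>) has_integral 0) {0..1}"
    by (simp add: D_def f0)
  have conth: "continuous_on {0..1} h"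
    unfolding h_def deriv_twist[OF hol]
    by (intro continuous_intros continuous_on_R continuous_on_R_over_q cf')
  have contj: "continuous_on {0..1} j"
    unfolding j_def by (intro continuous_intros continuous_on_R cf')
  have "((\<lambda>\<zeta>. \<kappa> * z * h \<zeta> - j \<zeta>) has_integral (\<kappa> * z * integral {0..1} h - integral {0..1} j)) {0..1}"
    by (intro has_integral_diff has_integral_mult_right integrable_integral
        integrable_continuous_interval conth contj)
  from has_integral_unique[OF this 1] have "integral {0..1} j = \<kappa> * z * integral {0..1} h"
    by simp
  then show ?thesis unfolding op_L_def j_def[abs_def] h_def[abs_def] .
qed

end

section \<open>The matrix of the operator on Taylor coefficients\<close>

context inversion_kernel
begin

lemma holomorphic_twist: "f holomorphic_on UNIV \<Longrightarrow> twist f holomorphic_on UNIV"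
  unfolding twist_def by (intro holomorphic_intros)

lemma taylor_coeff_deriv: "taylor_coeff (deriv f) n = of_nat (Suc n) * taylor_coeff f (Suc n)"
  by (simp add: taylor_coeff_def funpow_Suc_right del: funpow.simps of_nat_Suc)

text \<open>
  The powers of $q$ and $1-\zeta$ in $\mathfrak{R}$ conspire: whatever $i \le p$, the integrand is a
  constant times a \<open>beta_weight\<close> with the same exponent $a = -(p+1)\nu$.
\<close>

lemma kernel_moment:
  assumes "i \<le> p"
  shows "integral {0..1} (\<lambda>\<zeta>. R \<zeta> / q (of_real \<zeta>) * (of_real \<zeta> * R \<zeta>) ^ i * (- (q (of_real \<zeta>) * R \<zeta>)) ^ (p - i))
     = (- x) ^ (p - i) * fact i / pochhammer (1 - of_nat (Suc p) * \<nu>) (Suc i)"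
proof -
  define a where "a = - (of_nat (Suc p) * \<nu>)"
  have a: "Re a > 0"
    using Re_nu by (simp add: a_def mult_less_0_iff del: of_nat_Suc)
  have "R \<zeta> / q (of_real \<zeta>) * (of_real \<zeta> * R \<zeta>) ^ i * (- (q (of_real \<zeta>) * R \<zeta>)) ^ (p - i) =
      (-1) ^ (p - i) * x ^ Suc p * beta_weight a i \<zeta>" if \<zeta>: "\<zeta> \<in> {0..1}" for \<zeta>
  proof (cases "\<zeta> = 1")
    case True
    then show ?thesis by (simp add: kernel_R_def beta_weight_def)
  next
    case False
    let ?z = "complex_of_real \<zeta>"
    have ne: "1 - ?z \<noteq> 0" "q ?z \<noteq> 0" using False q_ne_0[OF \<zeta>] by auto
    have Rp: "R \<zeta> ^ Suc p = x ^ Suc p * (1 - ?z) powr a * q ?z powr (- a - of_nat (Suc p))"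
    proof -
      have "((1 - ?z) powr - \<nu>) ^ Suc p = (1 - ?z) powr a"
        by (subst powr_power[OF ne(1)]) (simp add: a_def)
      moreover have "(q ?z powr (\<nu> - 1)) ^ Suc p = q ?z powr (- a - of_nat (Suc p))"
        by (subst powr_power[OF ne(2)]) (simp add: a_def algebra_simps)
      ultimately show ?thesis unfolding kernel_R_def power_mult_distrib by simp
    qed
    have Rs: "R \<zeta> ^ Suc p = R \<zeta> * R \<zeta> ^ i * R \<zeta> ^ (p - i)"
      using assms by (simp flip: power_add)
    have "R \<zeta> / q ?z * (?z * R \<zeta>) ^ i * (- (q ?z * R \<zeta>)) ^ (p - i)
        = (-1) ^ (p - i) * (R \<zeta> ^ Suc p * ?z ^ i * (q ?z ^ (p - i) / q ?z))"
      unfolding Rs power_minus[of "q ?z * R \<zeta>"] power_mult_distrib by (simp add: mult_ac)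
    also have "\<dots> = (-1) ^ (p - i) * x ^ Suc p * ((1 - ?z) powr a * ?z ^ i *
        (q ?z powr (- a - of_nat (Suc p)) * q ?z ^ (p - i) / q ?z))"
      unfolding Rp by simp
    also have "q ?z powr (- a - of_nat (Suc p)) * q ?z ^ (p - i) / q ?z
        = q ?z powr (- a - of_nat (Suc p) + of_nat (p - i) - 1)"
      using ne by (simp add: powr_diff powr_add powr_minus divide_simps power2_eq_square)
    also have "- a - of_nat (Suc p) + of_nat (p - i) - 1 = - a - of_nat i - 2"
      using assms by (simp add: of_nat_diff)
    finally show ?thesis by (simp add: beta_weight_def)
  qed
  then have "integral {0..1} (\<lambda>\<zeta>. R \<zeta> / q (of_real \<zeta>) * (of_real \<zeta> * R \<zeta>) ^ i * (- (q (of_real \<zeta>) * R \<zeta>)) ^ (p - i))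
      = (-1) ^ (p - i) * x ^ Suc p * integral {0..1} (beta_weight a i)"
    by (subst integral_mult_right[symmetric]) (intro Henstock_Kurzweil_Integration.integral_cong, simp)
  also have "\<dots> = (-1) ^ (p - i) * x ^ (p - i) * fact i / pochhammer (1 + a) (Suc i)"
  proof -
    have "x ^ Suc p = x ^ (p - i) * x ^ Suc i"
      using assms by (simp flip: power_add)
    then show ?thesis unfolding integral_beta_weight[OF a] using x_ne_0 by simp
  qed
  finally show ?thesis by (subst power_minus) (simp add: a_def)
qed

text \<open>
  The matrix of the operator. Column $i$ acts on the Taylor coefficient of order $i + 1$ of the twist
  and row $p$ produces the coefficient of order $p + 1$; the matrix is lower triangular.
\<close>

lemma op_L_power_series:
  assumes f: "f \<in> H0"
  shows "(\<lambda>p. \<kappa> * (\<Sum>i\<le>p. taylor_coeff (twist f) (Suc i) * (- x) ^ (p - i) / fact (p - i) *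
      fact (Suc i) / pochhammer (1 - of_nat (Suc p) * \<nu>) (Suc i)) * z ^ Suc p) sums op_L x \<nu> f z"
proof -
  have hol: "f holomorphic_on UNIV" using f by (auto simp: H0_def)
  define g where "g = twist f"
  have gs: "(\<lambda>n. taylor_coeff (deriv g) n * u ^ n) sums deriv g u" for u
    unfolding g_def by (intro taylor_coeff_sums holomorphic_deriv holomorphic_twist hol) auto
  have es: "(\<lambda>n. 1 / fact n * u ^ n) sums exp u" for u :: complex
    using exp_converges[of u] by (simp add: scaleR_conv_of_real divide_inverse mult.commute)
  have "(\<lambda>p. (\<Sum>i\<le>p. taylor_coeff (deriv g) i * (1 / fact (p - i)) *
      integral {0..1} (\<lambda>\<zeta>. R \<zeta> / q (of_real \<zeta>) * (of_real \<zeta> * R \<zeta>) ^ i * (- (q (of_real \<zeta>) * R \<zeta>)) ^ (p - i))) * z ^ p)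
     sums integral {0..1} (\<lambda>\<zeta>. R \<zeta> / q (of_real \<zeta>) * deriv g (of_real \<zeta> * R \<zeta> * z) * exp (- (q (of_real \<zeta>) * R \<zeta>) * z))"
    by (rule integral_product_power_series[OF gs es])
      (intro continuous_intros continuous_on_R continuous_on_R_over_q)+
  from sums_mult[OF this, of "\<kappa> * z"]
  have "(\<lambda>p. \<kappa> * z * ((\<Sum>i\<le>p. taylor_coeff (deriv g) i * (1 / fact (p - i)) *
      integral {0..1} (\<lambda>\<zeta>. R \<zeta> / q (of_real \<zeta>) * (of_real \<zeta> * R \<zeta>) ^ i * (- (q (of_real \<zeta>) * R \<zeta>)) ^ (p - i))) * z ^ p))
     sums op_L x \<nu> f z"
    unfolding op_L_eq_integral_deriv_twist[OF f] g_def by simp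
  moreover have "\<kappa> * z * ((\<Sum>i\<le>p. taylor_coeff (deriv g) i * (1 / fact (p - i)) *
      integral {0..1} (\<lambda>\<zeta>. R \<zeta> / q (of_real \<zeta>) * (of_real \<zeta> * R \<zeta>) ^ i * (- (q (of_real \<zeta>) * R \<zeta>)) ^ (p - i))) * z ^ p)
    = \<kappa> * (\<Sum>i\<le>p. taylor_coeff g (Suc i) * (- x) ^ (p - i) / fact (p - i) *
      fact (Suc i) / pochhammer (1 - of_nat (Suc p) * \<nu>) (Suc i)) * z ^ Suc p" for p
  proof -
    have "(\<Sum>i\<le>p. taylor_coeff (deriv g) i * (1 / fact (p - i)) *
      integral {0..1} (\<lambda>\<zeta>. R \<zeta> / q (of_real \<zeta>) * (of_real \<zeta> * R \<zeta>) ^ i * (- (q (of_real \<zeta>) * R \<zeta>)) ^ (p - i)))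
      = (\<Sum>i\<le>p. taylor_coeff g (Suc i) * (- x) ^ (p - i) / fact (p - i) *
      fact (Suc i) / pochhammer (1 - of_nat (Suc p) * \<nu>) (Suc i))"
      by (intro sum.cong refl, subst kernel_moment) (auto simp: taylor_coeff_deriv fact_Suc)
    then show ?thesis by simp
  qed
  ultimately show ?thesis by (simp only: g_def)
qed

end

section \<open>The inverse kernel on a circle about 0\<close>

lemma higher_deriv_one_minus_powr:
  fixes a r :: complex
  assumes "norm r < 1"
  shows "(deriv ^^ k) (\<lambda>r. (1 - r) powr a) r = pochhammer (- a) k * (1 - r) powr (a - of_nat k)"
  using assms
proof (induction k arbitrary: r)
  case (Suc k)
  have nin: "1 - r \<notin> \<real>\<^sub>\<le>\<^sub>0"
    using Suc.prems abs_Re_le_cmod[of r] by (auto simp: complex_nonpos_Reals_iff)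
  have "\<forall>\<^sub>F s in nhds r. s \<in> ball 0 1"
    using Suc.prems by (intro eventually_nhds_in_open) auto
  then have "\<forall>\<^sub>F s in nhds r. (deriv ^^ k) (\<lambda>r. (1 - r) powr a) s =
      pochhammer (- a) k * (1 - s) powr (a - of_nat k)"
    by eventually_elim (use Suc.IH in auto)
  then have "(deriv ^^ Suc k) (\<lambda>r. (1 - r) powr a) r =
      deriv (\<lambda>s. pochhammer (- a) k * (1 - s) powr (a - of_nat k)) r"
    by (auto intro: deriv_cong_ev)
  also have "((\<lambda>s. pochhammer (- a) k * (1 - s) powr (a - of_nat k)) has_field_derivative
     pochhammer (- a) k * ((- a + of_nat k) * (1 - r) powr (a - of_nat k - 1))) (at r)"
    by (rule derivative_eq_intros refl nin | simp)+ (simp add: algebra_simps)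
  then have "deriv (\<lambda>s. pochhammer (- a) k * (1 - s) powr (a - of_nat k)) r =
     pochhammer (- a) k * ((- a + of_nat k) * (1 - r) powr (a - of_nat k - 1))"
    by (rule DERIV_imp_deriv)
  finally show ?case by (simp add: pochhammer_Suc algebra_simps)
qed simp

text \<open>
  Only an integer power of $1/r$ is present, so the Cauchy formula reads off a binomial coefficient of
  $(1-r)^a$.
\<close>

lemma circle_integral_one_minus_powr:
  "contour_integral (circlepath 0 (1/2)) (\<lambda>r. (1 - r) powr a / r ^ Suc k)
     = 2 * of_real pi * \<i> * pochhammer (- a) k / fact k"
proof -
  have nin: "1 - r \<notin> \<real>\<^sub>\<le>\<^sub>0" if "norm r \<le> 1/2" for r :: complex
    using that abs_Re_le_cmod[of r] by (auto simp: complex_nonpos_Reals_iff)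
  have "continuous_on (cball 0 (1/2)) (\<lambda>r. (1 - r) powr a)"
    "(\<lambda>r. (1 - r) powr a) holomorphic_on ball 0 (1/2)"
    by (intro holomorphic_on_imp_continuous_on holomorphic_intros, use nin in auto)+
  from Cauchy_has_contour_integral_higher_derivative_circlepath[OF this, of 0 k]
  show ?thesis by (auto dest!: contour_integral_unique simp: higher_deriv_one_minus_powr)
qed

context inversion_kernel
begin

text \<open>
  The value $0$ at $n = 0$ reflects $K(0) = 0$; it is singled out because of the truncated $n - 1$.
\<close>

definition circle_coeff :: "(complex \<Rightarrow> complex) \<Rightarrow> nat \<Rightarrow> complex" where
  "circle_coeff K n = (if n = 0 then 0 else
     - (2 * of_real pi * \<i>) * (\<Sum>i\<le>n. taylor_coeff K i * x ^ (n - i) / fact (n - i) *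
        pochhammer (1 - of_nat i * \<nu>) (n - 1) / fact (n - 1)))"

lemma circle_integral_power_series:
  assumes K: "K \<in> H0"
  shows "(\<lambda>n. circle_coeff K n * z ^ n) sums
     contour_integral (circlepath 0 (1/2)) (line_integrand x \<nu> K z)"
proof -
  have hol: "K holomorphic_on UNIV" and K0: "K 0 = 0" using K by (auto simp: H0_def)
  define c where "c = circlepath 0 (1/2)"
  have c_norm: "norm (c s) = 1/2" for s
    by (simp add: c_def circlepath norm_mult)
  have c_ne: "c s \<noteq> 0" "c s \<noteq> 1" "1 - c s \<noteq> 0" for s
    using c_norm[of s] by auto
  have nin: "1 - c s \<notin> \<real>\<^sub>\<le>\<^sub>0" for s
    using c_norm[of s] abs_Re_le_cmod[of "c s"] by (auto simp: complex_nonpos_Reals_iff)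
  have cont_c: "continuous_on {0..1} c"
    unfolding c_def circlepath by (intro continuous_intros)
  have c_der: "vector_derivative c (at s) = 2 * of_real pi * \<i> * c s" for s
    unfolding c_def vector_derivative_circlepath by (simp add: circlepath)
  have ci: "contour_integral c h = integral {0..1} (\<lambda>s. h (c s) * (2 * of_real pi * \<i> * c s))" for h
    by (simp add: contour_integral_integral c_der)
  define \<phi> where "\<phi> s = 2 * of_real pi * \<i> * c s / (c s - 1)" for s
  define \<alpha> where "\<alpha> s = (1 - c s) powr \<nu> / c s" for s
  define \<beta> where "\<beta> s = x / c s" for s
  have cont: "continuous_on {0..1} \<phi>" "continuous_on {0..1} \<alpha>" "continuous_on {0..1} \<beta>"
  proof -
    have "continuous_on {0..1} (\<lambda>s. (1 - c s) powr \<nu>)"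
      unfolding continuous_on_def
      by (intro ballI tendsto_powr_complex nin tendsto_intros)
        (use cont_c in \<open>auto simp: continuous_on_def\<close>)
    then show "continuous_on {0..1} \<alpha>" unfolding \<alpha>_def
      by (intro continuous_on_divide cont_c) (use c_ne in auto)
  qed (unfold \<phi>_def \<beta>_def, (intro continuous_intros cont_c; use c_ne in auto)+)
  have es: "(\<lambda>n. 1 / fact n * u ^ n) sums exp u" for u :: complex
    using exp_converges[of u] by (simp add: scaleR_conv_of_real divide_inverse mult.commute)
  have "(\<lambda>n. (\<Sum>i\<le>n. taylor_coeff K i * (1 / fact (n - i)) *
      integral {0..1} (\<lambda>s. \<phi> s * \<alpha> s ^ i * \<beta> s ^ (n - i))) * z ^ n)
      sums integral {0..1} (\<lambda>s. \<phi> s * K (\<alpha> s * z) * exp (\<beta> s * z))"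
    by (rule integral_product_power_series[OF taylor_coeff_sums[OF hol] es cont])
  moreover have "integral {0..1} (\<lambda>s. \<phi> s * K (\<alpha> s * z) * exp (\<beta> s * z)) =
      contour_integral c (line_integrand x \<nu> K z)"
    unfolding ci line_integrand_def \<phi>_def \<alpha>_def \<beta>_def by (simp add: mult_ac)
  moreover have "(\<Sum>i\<le>n. taylor_coeff K i * (1 / fact (n - i)) *
      integral {0..1} (\<lambda>s. \<phi> s * \<alpha> s ^ i * \<beta> s ^ (n - i))) = circle_coeff K n" for n
  proof (cases n)
    case 0
    then show ?thesis by (simp add: circle_coeff_def taylor_coeff_0 K0)
  next
    case (Suc k)
    have "integral {0..1} (\<lambda>s. \<phi> s * \<alpha> s ^ i * \<beta> s ^ (n - i)) =
       - (x ^ (n - i)) * (2 * of_real pi * \<i> * pochhammer (1 - of_nat i * \<nu>) k / fact k)"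
      if "i \<le> n" for i
    proof -
      have "\<phi> s * \<alpha> s ^ i * \<beta> s ^ (n - i) = - (x ^ (n - i)) *
         ((1 - c s) powr (of_nat i * \<nu> - 1) / c s ^ Suc k * (2 * of_real pi * \<i> * c s))" for s
      proof -
        have 1: "((1 - c s) powr \<nu>) ^ i = (1 - c s) powr (of_nat i * \<nu> - 1) * (1 - c s)"
          using c_ne[of s] by (simp add: powr_power powr_diff)
        have 2: "c s ^ Suc k = c s ^ i * c s ^ (n - i)"
          using that by (simp flip: power_add Suc)
        have 3: "c s - 1 = - (1 - c s)" by simp
        have 4: "T * d / - w * (P * w / C1) * (X / C2) = - X * (P / (C1 * C2) * (T * d))"
          if "w \<noteq> 0" for T d w P C1 C2 X :: complex
          using that by simp
        show ?thesis
          unfolding \<phi>_def \<alpha>_def \<beta>_def power_divide 1 2 3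
          by (rule 4[OF c_ne(3)])
      qed
      then have "integral {0..1} (\<lambda>s. \<phi> s * \<alpha> s ^ i * \<beta> s ^ (n - i)) = - (x ^ (n - i)) *
         contour_integral c (\<lambda>r. (1 - r) powr (of_nat i * \<nu> - 1) / r ^ Suc k)"
        unfolding ci by (simp only: integral_mult_right)
      then show ?thesis
        unfolding c_def circle_integral_one_minus_powr by simp
    qed
    then have "taylor_coeff K i * (1 / fact (n - i)) * integral {0..1} (\<lambda>s. \<phi> s * \<alpha> s ^ i * \<beta> s ^ (n - i))
        = - (2 * of_real pi * \<i>) * (taylor_coeff K i * x ^ (n - i) / fact (n - i) *
           pochhammer (1 - of_nat i * \<nu>) (n - 1) / fact (n - 1))" if "i \<le> n" for i
      using that by (simp add: Suc mult_ac)
    moreover have "n \<noteq> 0" using Suc by simp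
    ultimately show ?thesis
      unfolding circle_coeff_def sum_distrib_left by (simp only: if_False) (intro sum.cong, auto)
  qed
  ultimately show ?thesis by (simp add: c_def)
qed

end

section \<open>Bijectivity and the inverse operator\<close>

context inversion_kernel
begin

text \<open>
  The inversion formula without its factor $e^{(1-x)z}$, over the contour on which it is manifestly an
  entire function of $z$.
\<close>

definition untwisted_inverse :: "(complex \<Rightarrow> complex) \<Rightarrow> complex \<Rightarrow> complex" where
  "untwisted_inverse K z = (1 - x) / (2 * \<i> * of_real pi * x) *
     contour_integral (circlepath 0 (1/2)) (line_integrand x \<nu> K z)"

definition inverse_L :: "(complex \<Rightarrow> complex) \<Rightarrow> complex \<Rightarrow> complex" where
  "inverse_L K z = exp ((1 - x) * z) * untwisted_inverse K z"

definition inverse_coeff :: "(complex \<Rightarrow> complex) \<Rightarrow> nat \<Rightarrow> complex" where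
  "inverse_coeff K n = (1 - x) / (2 * \<i> * of_real pi * x) * circle_coeff K n"

lemma untwisted_inverse_sums:
  "K \<in> H0 \<Longrightarrow> (\<lambda>n. inverse_coeff K n * z ^ n) sums untwisted_inverse K z"
  unfolding untwisted_inverse_def inverse_coeff_def mult.assoc
  by (intro sums_mult circle_integral_power_series)

lemma holomorphic_untwisted_inverse:
  assumes "K \<in> H0"
  shows "untwisted_inverse K holomorphic_on UNIV"
proof -
  have "untwisted_inverse K holomorphic_on ball 0 r" for r
    by (rule power_series_holomorphic[where a = "inverse_coeff K"])
      (use untwisted_inverse_sums[OF assms] in simp)
  then show ?thesis
    by (metis holomorphic_on_imp_differentiable_at holomorphic_on_def field_differentiable_at_within
        open_ball mem_ball_0 less_add_one)
qed

lemma taylor_coeff_untwisted_inverse: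
  assumes "K \<in> H0"
  shows "taylor_coeff (untwisted_inverse K) = inverse_coeff K"
  by (rule power_series_coeffs_unique[OF taylor_coeff_sums[OF holomorphic_untwisted_inverse[OF assms]]
        untwisted_inverse_sums[OF assms]])

lemma inverse_L_in_H0:
  assumes "K \<in> H0"
  shows "inverse_L K \<in> H0"
proof -
  have "untwisted_inverse K 0 = 0"
    using sums_unique2[OF untwisted_inverse_sums[OF assms, of 0] powser_sums_zero]
    by (simp add: inverse_coeff_def circle_coeff_def)
  moreover have "inverse_L K holomorphic_on UNIV"
    unfolding inverse_L_def by (intro holomorphic_intros holomorphic_untwisted_inverse assms)
  ultimately show ?thesis by (simp add: H0_def inverse_L_def)
qed

lemma twist_inverse_L: "twist (inverse_L K) = untwisted_inverse K"
proof
  fix u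
  have "exp (- (1 - x) * u) * exp ((1 - x) * u) = 1"
    by (simp add: algebra_simps flip: exp_add)
  then show "twist (inverse_L K) u = untwisted_inverse K u"
    by (simp add: twist_def inverse_L_def flip: mult.assoc)
qed

text \<open>
  After interchanging the two finite sums, the coefficient of $K_m$ in row $p + 1$ is the alternating
  Pochhammer sum with $N = p + 1 - m$.
\<close>

lemma op_L_inverse_L:
  assumes K: "K \<in> H0"
  shows "op_L x \<nu> (inverse_L K) = K"
proof
  fix z
  have hol: "K holomorphic_on UNIV" and K0: "K 0 = 0" using K by (auto simp: H0_def)
  let ?k = "taylor_coeff K"
  have nz: "1 - \<nu> \<noteq> 0" using Re_nu by auto
  have coeff: "\<kappa> * (\<Sum>i\<le>p. inverse_coeff K (Suc i) * (- x) ^ (p - i) / fact (p - i) *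
      fact (Suc i) / pochhammer (1 - of_nat (Suc p) * \<nu>) (Suc i)) = ?k (Suc p)" for p
  proof -
    define b where "b = 1 - of_nat (Suc p) * \<nu>"
    \<comment> \<open>up to a sign and a factorial, the summand of \<open>alternating_pochhammer_sum\<close> with \<open>j = i + 1 - m\<close>\<close>
    define t where "t m i = (- 1) ^ (p - i) * of_nat (Suc i) * pochhammer (1 - of_nat m * \<nu>) i /
       (fact (p - i) * fact (Suc i - m) * pochhammer b (Suc i))" for m i
    \<comment> \<open>all scalar prefactors of the two matrices multiply to the constant of \<open>alternating_pochhammer_sum\<close>\<close>
    have const: "\<kappa> * ((1 - x) / (2 * \<i> * of_real pi * x)) * (- (2 * of_real pi * \<i>)) = 1 - \<nu>"
      using x_ne_0 x_ne_1 by (simp add: \<kappa>_def field_simps)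
    have "\<kappa> * (inverse_coeff K (Suc i) * (- x) ^ (p - i) / fact (p - i) *
      fact (Suc i) / pochhammer b (Suc i)) =
      (\<Sum>m\<le>Suc i. (1 - \<nu>) * ?k m * x ^ (Suc p - m) * t m i)" if "i \<le> p" for i
    proof -
      have "\<kappa> * (inverse_coeff K (Suc i) * (- x) ^ (p - i) / fact (p - i) *
        fact (Suc i) / pochhammer b (Suc i)) =
        (\<kappa> * ((1 - x) / (2 * \<i> * of_real pi * x)) * (- (2 * of_real pi * \<i>))) *
         ((\<Sum>m\<le>Suc i. ?k m * x ^ (Suc i - m) / fact (Suc i - m) *
        pochhammer (1 - of_nat m * \<nu>) i / fact i) * ((- x) ^ (p - i) / fact (p - i) *
        fact (Suc i) / pochhammer b (Suc i)))"
      proof -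
        have gen: "\<kappa> * (C * (D * S) * X / f * F / P) = (\<kappa> * C * D) * (S * (X / f * F / P))"
          for C D S X f F P :: complex by simp
        show ?thesis
          unfolding inverse_coeff_def circle_coeff_def
          by (simp only: nat.distinct if_False diff_Suc_1) (rule gen)
      qed
      also have "\<dots> = (\<Sum>m\<le>Suc i. (1 - \<nu>) * (?k m * x ^ (Suc i - m) / fact (Suc i - m) *
        pochhammer (1 - of_nat m * \<nu>) i / fact i * ((- x) ^ (p - i) / fact (p - i) *
        fact (Suc i) / pochhammer b (Suc i))))"
        unfolding const sum_distrib_left sum_distrib_right ..
      also have "\<dots> = (\<Sum>m\<le>Suc i. (1 - \<nu>) * ?k m * x ^ (Suc p - m) * t m i)"
      proof (intro sum.cong refl)
        fix m assume "m \<in> {..Suc i}"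
        then have xp: "x ^ (Suc p - m) = x ^ (Suc i - m) * x ^ (p - i)"
          using that by (simp flip: power_add)
        have fs: "(fact (Suc i) :: complex) = of_nat (Suc i) * fact i" by simp
        show "(1 - \<nu>) * (?k m * x ^ (Suc i - m) / fact (Suc i - m) *
          pochhammer (1 - of_nat m * \<nu>) i / fact i * ((- x) ^ (p - i) / fact (p - i) *
          fact (Suc i) / pochhammer b (Suc i))) = (1 - \<nu>) * ?k m * x ^ (Suc p - m) * t m i"
          unfolding t_def xp power_minus[of x] fs by (simp add: mult_ac)
      qed
      finally show ?thesis .
    qed
    then have "\<kappa> * (\<Sum>i\<le>p. inverse_coeff K (Suc i) * (- x) ^ (p - i) / fact (p - i) *
      fact (Suc i) / pochhammer b (Suc i)) =
      (\<Sum>i\<le>p. \<Sum>m\<le>Suc i. (1 - \<nu>) * ?k m * x ^ (Suc p - m) * t m i)"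
      by (simp only: sum_distrib_left) (intro sum.cong, auto)
    also have "\<dots> = (\<Sum>m\<le>Suc p. \<Sum>i | i \<le> p \<and> m \<le> Suc i. (1 - \<nu>) * ?k m * x ^ (Suc p - m) * t m i)"
      by (subst sum.Sigma, simp, simp, subst sum.Sigma, simp, simp, rule sum.reindex_bij_witness[of _ "\<lambda>(m, i). (i, m)" "\<lambda>(i, m). (m, i)"]) auto
    also have "\<dots> = (\<Sum>m\<le>Suc p. if m = Suc p then ?k m else 0)"
    proof (intro sum.cong refl)
      fix m assume m: "m \<in> {..Suc p}"
      show "(\<Sum>i | i \<le> p \<and> m \<le> Suc i. (1 - \<nu>) * ?k m * x ^ (Suc p - m) * t m i) =
        (if m = Suc p then ?k m else 0)"
      proof (cases "m = 0")
        case True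
        then show ?thesis by (simp add: taylor_coeff_0 K0)
      next
        case False
        define N where "N = Suc p - m"
        have N: "Suc p = m + N" using m by (simp add: N_def)
        have "(\<Sum>i | i \<le> p \<and> m \<le> Suc i. t m i) = (\<Sum>j\<le>N. t m (m + j - 1))"
          by (rule sum.reindex_bij_witness[of _ "\<lambda>j. m + j - 1" "\<lambda>i. Suc i - m"]) (use False m in \<open>auto simp: N_def\<close>)
        also have "\<dots> = (\<Sum>j\<le>N. (-1) ^ N / fact N * ((-1) ^ j * of_nat (N choose j) * of_nat (m + j) *
           pochhammer (1 - of_nat m * \<nu>) (m + j - 1) / pochhammer (1 - of_nat (m + N) * \<nu>) (m + j)))"
        proof (intro sum.cong refl)
          fix j assume "j \<in> {..N}"
          then have j: "j \<le> N" by simp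
          have e: "p - (m + j - 1) = N - j" "Suc (m + j - 1) = m + j" "m + j - m = j"
            using False N j by auto
          obtain d where d: "N = d + j" using j by (metis le_add_diff_inverse2)
          have "(-1 :: complex) ^ j * (-1) ^ j = 1" by (simp flip: power_mult_distrib)
          then have s: "(-1 :: complex) ^ (N - j) = (-1) ^ N * (-1) ^ j"
            by (simp add: d power_add mult.assoc)
          show "t m (m + j - 1) = (-1) ^ N / fact N * ((-1) ^ j * of_nat (N choose j) * of_nat (m + j) *
           pochhammer (1 - of_nat m * \<nu>) (m + j - 1) / pochhammer (1 - of_nat (m + N) * \<nu>) (m + j))"
            unfolding t_def e s b_def N binomial_fact[OF j] by (simp add: mult_ac)
        qed
        finally have "(1 - \<nu>) * (\<Sum>i | i \<le> p \<and> m \<le> Suc i. t m i) =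
           (-1) ^ N / fact N * ((1 - \<nu>) * (\<Sum>j\<le>N. ((-1) ^ j * of_nat (N choose j) * of_nat (m + j) *
           pochhammer (1 - of_nat m * \<nu>) (m + j - 1) / pochhammer (1 - of_nat (m + N) * \<nu>) (m + j))))"
          by (simp add: sum_distrib_left mult_ac)
        also have "\<dots> = (if N = 0 then 1 else 0)"
          using False by (subst alternating_pochhammer_sum[OF Re_nu]) auto
        finally have "(1 - \<nu>) * (\<Sum>i | i \<le> p \<and> m \<le> Suc i. t m i) = (if N = 0 then 1 else 0)" .
        then have "?k m * x ^ N * ((1 - \<nu>) * (\<Sum>i | i \<le> p \<and> m \<le> Suc i. t m i)) = (if N = 0 then ?k m else 0)"
          by simp
        then show ?thesis
          using m by (simp add: N_def sum_distrib_left mult_ac split: if_splits)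
      qed
    qed
    also have "\<dots> = ?k (Suc p)" by simp
    finally show ?thesis unfolding b_def .
  qed
  have "(\<lambda>p. ?k (Suc p) * z ^ Suc p) sums op_L x \<nu> (inverse_L K) z"
    using op_L_power_series[OF inverse_L_in_H0[OF K], of z]
    unfolding twist_inverse_L taylor_coeff_untwisted_inverse[OF K] coeff .
  moreover have "(\<lambda>p. ?k (Suc p) * z ^ Suc p) sums K z"
    using taylor_coeff_sums[OF hol, of z] sums_Suc_iff[of "\<lambda>n. ?k n * z ^ n"]
    by (simp add: taylor_coeff_0 K0 del: power_Suc)
  ultimately show "op_L x \<nu> (inverse_L K) z = K z" by (rule sums_unique2)
qed

text \<open>
  Forward substitution in a lower triangular system with nonzero diagonal determines the Taylor
  coefficients of the twist, hence the function.
\<close>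

lemma op_L_inj_on: "inj_on (op_L x \<nu>) H0"
proof (rule inj_onI)
  fix f h assume f: "f \<in> H0" and h: "h \<in> H0" and eq: "op_L x \<nu> f = op_L x \<nu> h"
  have hol: "f holomorphic_on UNIV" "h holomorphic_on UNIV" and z0: "f 0 = 0" "h 0 = 0"
    using f h by (auto simp: H0_def)
  define A where "A p i = (- x) ^ (p - i) / fact (p - i) *
      fact (Suc i) / pochhammer (1 - of_nat (Suc p) * \<nu>) (Suc i)" for p i
  define cf where "cf f n = (case n of 0 \<Rightarrow> 0 | Suc p \<Rightarrow>
     \<kappa> * (\<Sum>i\<le>p. taylor_coeff (twist f) (Suc i) * A p i))" for f n
  have sums: "(\<lambda>n. cf f n * z ^ n) sums op_L x \<nu> f z" if "f \<in> H0" for f z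
  proof -
    have "(\<lambda>p. cf f (Suc p) * z ^ Suc p) sums op_L x \<nu> f z"
      using op_L_power_series[OF that, of z]
      by (simp add: cf_def A_def mult.assoc del: power_Suc of_nat_Suc fact_Suc)
    then show ?thesis
      by (subst (asm) sums_Suc_iff) (simp add: cf_def)
  qed
  have cfeq: "cf f = cf h"
    by (rule power_series_coeffs_unique[OF sums[OF f]]) (use sums[OF h] eq in simp)
  have tw: "taylor_coeff (twist f) n = taylor_coeff (twist h) n" for n
  proof (induction n rule: less_induct)
    case (less n)
    show ?case
    proof (cases n)
      case 0
      then show ?thesis by (simp add: taylor_coeff_0 twist_def z0)
    next
      case (Suc p)
      have "\<kappa> \<noteq> 0" using x_ne_0 x_ne_1 Re_nu by (auto simp: \<kappa>_def)
      then have "(\<Sum>i\<le>p. taylor_coeff (twist f) (Suc i) * A p i) = (\<Sum>i\<le>p. taylor_coeff (twist h) (Suc i) * A p i)"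
        using fun_cong[OF cfeq, of "Suc p"] by (simp add: cf_def)
      moreover have "(\<Sum>i<p. taylor_coeff (twist f) (Suc i) * A p i) = (\<Sum>i<p. taylor_coeff (twist h) (Suc i) * A p i)"
        by (intro sum.cong refl) (use less Suc in auto)
      ultimately have "taylor_coeff (twist f) (Suc p) * A p p = taylor_coeff (twist h) (Suc p) * A p p"
        by (simp flip: lessThan_Suc_atMost)
      moreover have "A p p \<noteq> 0"
        using pochhammer_ne_0_of_Re_pos[OF Re_shift_pos[OF Re_nu]] by (simp add: A_def del: pochhammer_Suc of_nat_Suc)
      ultimately show ?thesis using Suc by simp
    qed
  qed
  have "twist f u = twist h u" for u
    using taylor_coeff_sums[OF holomorphic_twist[OF hol(1)], of u]
      taylor_coeff_sums[OF holomorphic_twist[OF hol(2)], of u] tw sums_unique2 by simp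
  then show "f = h" by (simp add: twist_def fun_eq_iff)
qed

end

section \<open>From the circle to vertical lines\<close>

lemma tendsto_symmetric_integral:
  fixes f :: "real \<Rightarrow> complex"
  assumes "(f has_integral I) UNIV"
  shows "((\<lambda>T. integral {-T..T} f) \<longlongrightarrow> I) at_top"
proof (rule tendstoI)
  fix e :: real assume "e > 0"
  then obtain B where "B > 0"
    and B: "\<And>a b. ball 0 B \<subseteq> cbox a b \<Longrightarrow> norm (integral (cbox a b) (\<lambda>x. if x \<in> UNIV then f x else 0) - I) < e"
    using assms unfolding has_integral_alt'[of f I UNIV] by meson
  have "dist (integral {-T..T} f) I < e" if "T \<ge> B" for T
  proof -
    have "ball 0 B \<subseteq> cbox (-T) T" using that by (auto simp: dist_norm)
    from B[OF this] show ?thesis by (simp add: dist_norm)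
  qed
  then show "\<forall>\<^sub>F T in at_top. dist (integral {-T..T} f) I < e"
    by (auto simp: eventually_at_top_linorder)
qed

lemma integrable_inverse_one_plus_square: "integrable lborel (\<lambda>s::real. inverse (1 + s\<^sup>2))"
proof -
  have "set_integrable lborel (einterval (-\<infinity>) \<infinity>) (\<lambda>s. inverse (1 + s\<^sup>2))"
  proof (rule interval_integral_FTC_nonneg(1))
    show "(arctan has_real_derivative inverse (1 + s\<^sup>2)) (at s)" for s
      by (rule DERIV_arctan)
    show "isCont (\<lambda>s. inverse (1 + s\<^sup>2)) s" for s :: real
      by (intro continuous_intros) (auto simp: add_nonneg_eq_0_iff)
    show "((arctan \<circ> real_of_ereal) \<longlongrightarrow> - (pi/2)) (at_right (-\<infinity>))"
      by (simp only: ereal_tendsto_simps tendsto_arctan_at_bot)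
    show "((arctan \<circ> real_of_ereal) \<longlongrightarrow> pi/2) (at_left \<infinity>)"
      by (simp only: ereal_tendsto_simps tendsto_arctan_at_top)
  qed auto
  then show ?thesis by (simp add: set_integrable_def)
qed

lemma integrable_of_inverse_square_decay:
  fixes f :: "real \<Rightarrow> complex"
  assumes cont: "continuous_on UNIV f" and decay: "\<And>s. \<bar>s\<bar> \<ge> M \<Longrightarrow> norm (f s) \<le> C / s\<^sup>2" and M: "M \<ge> 1"
  shows "integrable lborel f"
proof -
  have "bounded (f ` {-M..M})"
    by (intro compact_imp_bounded compact_continuous_image continuous_on_subset[OF cont]) auto
  then obtain B where B: "\<And>s. s \<in> {-M..M} \<Longrightarrow> norm (f s) \<le> B" unfolding bounded_iff by blast
  have B0: "B \<ge> 0" using M by (intro order_trans[OF norm_ge_zero B[of M]]) auto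
  have C0: "C \<ge> 0"
    using order_trans[OF norm_ge_zero decay[of M]] M by (auto simp: zero_le_divide_iff)
  \<comment> \<open>the first summand covers the compact range of \<open>s\<close>, the second one the rest\<close>
  define D where "D = B * (1 + M\<^sup>2) + 2 * C"
  have bound: "norm (f s) \<le> D * inverse (1 + s\<^sup>2)" for s
  proof (cases "\<bar>s\<bar> \<le> M")
    case True
    then have "s\<^sup>2 \<le> M\<^sup>2" by (metis abs_le_square_iff abs_of_nonneg M order_trans zero_le_one)
    then have "B * (1 + s\<^sup>2) \<le> D" using B0 C0 by (simp add: D_def add_increasing2 mult_left_mono)
    then have "B \<le> D * inverse (1 + s\<^sup>2)"
      by (simp add: field_simps add_pos_nonneg)
    moreover have "norm (f s) \<le> B" using True by (intro B) auto
    ultimately show ?thesis by (rule order_trans[rotated])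
  next
    case False
    have "1 \<le> s\<^sup>2" using False M by (metis abs_le_square_iff abs_one linear order_trans one_power2)
    then have "C * (1 + s\<^sup>2) \<le> C * (2 * s\<^sup>2)" using C0 by (intro mult_left_mono) auto
    also have "\<dots> \<le> D * s\<^sup>2"
      using B0 by (simp add: D_def algebra_simps)
    finally have "C \<le> D * s\<^sup>2 / (1 + s\<^sup>2)"
      by (simp add: pos_le_divide_eq add_pos_nonneg)
    then have "C / s\<^sup>2 \<le> D * s\<^sup>2 / (1 + s\<^sup>2) / s\<^sup>2"
      by (rule divide_right_mono) simp
    also have "\<dots> = D * inverse (1 + s\<^sup>2)"
    proof -
      have "s \<noteq> 0" using \<open>1 \<le> s\<^sup>2\<close> by auto
      then show ?thesis by (simp add: divide_inverse)
    qed
    finally show ?thesis using decay[of s] False by auto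
  qed
  show ?thesis
  proof (rule Bochner_Integration.integrable_bound)
    show "integrable lborel (\<lambda>s. D * inverse (1 + s\<^sup>2))"
      by (intro integrable_mult_right integrable_inverse_one_plus_square)
    show "f \<in> borel_measurable lborel"
      using cont by (simp add: borel_measurable_continuous_onI)
    show "AE s in lborel. norm (f s) \<le> norm (D * inverse (1 + s\<^sup>2))"
    proof (intro always_eventually allI)
      fix s
      show "norm (f s) \<le> norm (D * inverse (1 + s\<^sup>2))"
        using bound[of s] abs_ge_self[of "D * inverse (1 + s\<^sup>2)"] unfolding real_norm_def by (rule order_trans)
    qed
  qed
qed

lemma H0_linear_bound:
  assumes "K \<in> H0"
  obtains B where "B \<ge> 0" "\<And>v. norm v \<le> M \<Longrightarrow> norm (K v) \<le> B * norm v"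
proof -
  have hol: "K holomorphic_on UNIV" and K0: "K 0 = 0" using assms by (auto simp: H0_def)
  have "continuous_on (cball 0 M) (deriv K)"
    by (intro holomorphic_on_imp_continuous_on holomorphic_on_subset[OF holomorphic_deriv[OF hol]]) auto
  then have "bounded (deriv K ` cball 0 M)"
    by (intro compact_imp_bounded compact_continuous_image) auto
  then obtain B where B: "\<And>v. v \<in> cball 0 M \<Longrightarrow> norm (deriv K v) \<le> B" unfolding bounded_iff by blast
  show ?thesis
  proof
    fix v :: complex assume "norm v \<le> M"
    moreover have "(K has_field_derivative deriv K w) (at w within cball 0 M)" for w
      using hol holomorphic_derivI[of K UNIV w] has_field_derivative_at_within by auto
    ultimately have "norm (K v - K 0) \<le> B * norm (v - 0)"
      using order_trans[OF norm_ge_zero \<open>norm v \<le> M\<close>] B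
      by (intro field_differentiable_bound[OF convex_cball[of 0 M], of _ "deriv K"]) auto
    moreover have "B * norm v \<le> max B 0 * norm v" by (intro mult_right_mono) auto
    ultimately show "norm (K v) \<le> max B 0 * norm v" using K0 by simp
  qed simp
qed

text \<open>
  For $|r| \ge 2$ the base satisfies $|1-r| \ge 1$, so $|(1-r)^\nu|$ is bounded because
  $\mathrm{Re}\,\nu < 0$. The argument of $K$ is then $O(1/|r|)$, and $K(0) = 0$ gains one factor $1/|r|$ beyond
  the one from $1/(r-1)$.
\<close>

lemma line_integrand_decay:
  assumes K: "K \<in> H0" and Re_nu: "Re \<nu> < 0"
  obtains C where "\<And>r. norm r \<ge> 2 \<Longrightarrow> norm (line_integrand x \<nu> K z r) \<le> C / (norm r)\<^sup>2"
proof -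
  \<comment> \<open>bounds the argument of \<open>K\<close> for \<open>norm r \<ge> 2\<close>\<close>
  define E where "E = norm z * exp (\<bar>Im \<nu>\<bar> * pi)"
  have "E \<ge> 0" by (simp add: E_def)
  obtain B where "B \<ge> 0" and B: "\<And>v. norm v \<le> E \<Longrightarrow> norm (K v) \<le> B * norm v"
    by (rule H0_linear_bound[OF K, of E]) blast
  show ?thesis
  proof
    fix r :: complex assume r: "norm r \<ge> 2"
    have "norm r - 1 \<le> norm (1 - r)" using norm_triangle_ineq2[of r 1] by (simp add: norm_minus_commute)
    then have r1: "norm (1 - r) \<ge> norm r / 2" "norm (1 - r) \<ge> 1" using r by auto
    have "norm (1 - r) powr Re \<nu> \<le> norm (1 - r) powr 0"
      using r1 Re_nu by (intro powr_mono) auto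
    also have "\<dots> = 1" using r1 by auto
    finally have le1: "norm (1 - r) powr Re \<nu> \<le> 1" .
    have "- Im \<nu> * Arg (1 - r) \<le> \<bar>Im \<nu>\<bar> * \<bar>Arg (1 - r)\<bar>"
      by (metis abs_ge_self abs_minus_cancel abs_mult)
    also have "\<dots> \<le> \<bar>Im \<nu>\<bar> * pi"
      using Arg_le_pi[of "1 - r"] mpi_less_Arg[of "1 - r"] by (intro mult_left_mono) auto
    finally have "norm ((1 - r) powr \<nu>) \<le> exp (\<bar>Im \<nu>\<bar> * pi)"
      unfolding norm_powr_complex using mult_mono[OF le1, of "exp (- Im \<nu> * Arg (1 - r))" "exp (\<bar>Im \<nu>\<bar> * pi)"]
      by simp
    then have v: "norm (z * (1 - r) powr \<nu> / r) \<le> E / norm r"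
      unfolding norm_divide norm_mult E_def by (intro divide_right_mono mult_left_mono) auto
    have "E / norm r \<le> E"
      using r \<open>E \<ge> 0\<close> mult_left_mono[of 1 "norm r" E] by (auto simp: divide_le_eq)
    then have "norm (K (z * (1 - r) powr \<nu> / r)) \<le> B * norm (z * (1 - r) powr \<nu> / r)"
      using v by (intro B) auto
    also have "\<dots> \<le> B * (E / norm r)"
      using v \<open>B \<ge> 0\<close> by (intro mult_left_mono)
    finally have k: "norm (K (z * (1 - r) powr \<nu> / r)) \<le> B * (E / norm r)" .
    have "norm (exp (x * z / r)) \<le> exp (norm (x * z / r))" by (rule norm_exp)
    also have "norm (x * z / r) \<le> norm (x * z)"
      using r mult_left_mono[of 1 "norm r" "norm (x * z)"] by (auto simp: norm_divide divide_le_eq)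
    finally have e: "norm (exp (x * z / r)) \<le> exp (norm (x * z))" by simp
    have "norm (exp (x * z / r) / (r - 1)) \<le> exp (norm (x * z)) / (norm r / 2)"
      unfolding norm_divide using e r1 r by (intro frac_le) (auto simp: norm_minus_commute)
    then have "norm (line_integrand x \<nu> K z r) \<le> exp (norm (x * z)) / (norm r / 2) * (B * (E / norm r))"
      unfolding line_integrand_def norm_mult[of "_ / _"] using k by (intro mult_mono) auto
    also have "\<dots> = (2 * exp (norm (x * z)) * B * E) / (norm r)\<^sup>2"
      by (simp add: power2_eq_square)
    finally show "norm (line_integrand x \<nu> K z r) \<le> (2 * exp (norm (x * z)) * B * E) / (norm r)\<^sup>2" .
  qed
qed

lemma holomorphic_line_integrand:
  assumes "K \<in> H0"
  shows "line_integrand x \<nu> K z holomorphic_on {r. Re r < 1} - {0}"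
proof -
  have hol: "K holomorphic_on UNIV" using assms by (auto simp: H0_def)
  have "(\<lambda>r. z * (1 - r) powr \<nu> / r) holomorphic_on {r. Re r < 1} - {0}"
    by (intro holomorphic_intros) (auto simp: complex_nonpos_Reals_iff)
  then have "(K \<circ> (\<lambda>r. z * (1 - r) powr \<nu> / r)) holomorphic_on {r. Re r < 1} - {0}"
    by (rule holomorphic_on_compose) (rule holomorphic_on_subset[OF hol], simp)
  then show ?thesis
    unfolding line_integrand_def o_def by (intro holomorphic_intros) auto
qed

text \<open>
  The rectangle with corners $-T - iT$ and $c + iT$ lies in the convex half-plane $\mathrm{Re}\,r < 1$,
  where $0$ is the only singularity. On its left, upper and lower sides the decay $O(T^{-2})$ beats the
  length $O(T)$, and its right side exhausts the line. The third claim keeps the symmetric limit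
  available for the comparison with loops.
\<close>

proposition line_integral_eq_circle_integral:
  assumes K: "K \<in> H0" and Re_nu: "Re \<nu> < 0" and c: "0 < c" "c < 1"
  shows "vertical_integrable c (line_integrand x \<nu> K z)"
    and "vertical_integral c (line_integrand x \<nu> K z) =
      contour_integral (circlepath 0 (1/2)) (line_integrand x \<nu> K z)"
    and "((\<lambda>T. \<i> * integral {-T..T} (\<lambda>s. line_integrand x \<nu> K z (Complex c s)))
      \<longlongrightarrow> vertical_integral c (line_integrand x \<nu> K z)) at_top"
proof -
  define P where "P = line_integrand x \<nu> K z"
  have hol: "P holomorphic_on {r. Re r < 1} - {0}"
    unfolding P_def by (rule holomorphic_line_integrand[OF K])
  have contP: "continuous_on S P" if "S \<subseteq> {r. Re r < 1} - {0}" for S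
    using holomorphic_on_imp_continuous_on[OF hol] that continuous_on_subset by blast
  obtain C where C: "\<And>r. norm r \<ge> 2 \<Longrightarrow> norm (P r) \<le> C / (norm r)\<^sup>2"
    unfolding P_def by (rule line_integrand_decay[OF K Re_nu, of x z]) blast
  have C0: "C \<ge> 0"
    using order_trans[OF norm_ge_zero C[of 2]] by simp
  have Cbig: "norm (P r) \<le> C / T\<^sup>2" if "T \<ge> 2" "norm r \<ge> T" for r T
  proof -
    have "C / (norm r)\<^sup>2 \<le> C / T\<^sup>2"
      using that C0 by (intro divide_left_mono power_mono mult_pos_pos) auto
    then show ?thesis using C[of r] that by simp
  qed
  have int: "integrable lborel (\<lambda>s. P (Complex c s))"
  proof (rule integrable_of_inverse_square_decay)
    show "continuous_on UNIV (\<lambda>s. P (Complex c s))"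
      by (rule continuous_on_compose2[OF contP[of "{r. Re r = c}"]])
        (use c in \<open>auto intro!: continuous_intros simp: Complex_eq\<close>)
    show "norm (P (Complex c s)) \<le> C / s\<^sup>2" if "\<bar>s\<bar> \<ge> 2" for s
      using Cbig[of "\<bar>s\<bar>" "Complex c s"] that abs_Im_le_cmod[of "Complex c s"] by simp
  qed simp
  then show "vertical_integrable c (line_integrand x \<nu> K z)"
    by (simp add: vertical_integrable_def P_def)
  have lim: "((\<lambda>T. \<i> * integral {-T..T} (\<lambda>s. P (Complex c s))) \<longlongrightarrow> vertical_integral c P) at_top"
    unfolding vertical_integral_def
    by (intro tendsto_intros tendsto_symmetric_integral has_integral_integral_lborel int)
  then show "((\<lambda>T. \<i> * integral {-T..T} (\<lambda>s. line_integrand x \<nu> K z (Complex c s)))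
      \<longlongrightarrow> vertical_integral c (line_integrand x \<nu> K z)) at_top"
    by (simp add: P_def)
  define J where "J = contour_integral (circlepath 0 (1/2)) P"
  have op: "open {r. Re r < 1}" by (rule open_halfspace_Re_lt)
  have J: "J = 2 * pi * \<i> * residue P 0"
    unfolding J_def using op hol
    by (intro contour_integral_unique base_residue[of "{r. Re r < 1}"])
      (auto simp: dist_norm intro: le_less_trans[OF complex_Re_le_cmod])
  have rect: "norm (J - \<i> * integral {-T..T} (\<lambda>s. P (Complex c s))) \<le> 6 * C / T" if T: "T \<ge> 2" for T
  proof -
    define a1 a2 a3 a4 where "a1 = Complex (-T) (-T)" and "a2 = Complex c (-T)"
      and "a3 = Complex c T" and "a4 = Complex (-T) T"
    have box: "path_image (rectpath a1 a3) \<subseteq> {r. Re r < 1} - {0}"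
      using c T by (subst path_image_rectpath) (auto simp: a1_def a3_def complex_eq_iff)
    have "contour_integral (rectpath a1 a3) P =
        2 * pi * \<i> * (\<Sum>p\<in>{0}. winding_number (rectpath a1 a3) p * residue P p)"
    proof (rule Residue_theorem[OF op _ _ hol])
      show "connected {r. Re r < 1}" by (intro convex_connected convex_halfspace_Re_lt)
      show "\<forall>w. w \<notin> {r. Re r < 1} \<longrightarrow> winding_number (rectpath a1 a3) w = 0"
        using c T by (auto intro!: winding_number_rectpath_outside simp: a1_def a3_def in_cbox_complex_iff)
    qed (use box in auto)
    moreover have "winding_number (rectpath a1 a3) 0 = 1"
      using c T by (intro winding_number_rectpath) (auto simp: a1_def a3_def in_box_complex_iff)
    ultimately have R: "contour_integral (rectpath a1 a3) P = J" by (simp add: J)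
    have segs: "closed_segment a1 a2 \<subseteq> {r. Im r = -T \<and> Re r < 1}" "closed_segment a2 a3 \<subseteq> {r. Re r = c}"
       "closed_segment a3 a4 \<subseteq> {r. Im r = T \<and> Re r < 1}" "closed_segment a4 a1 \<subseteq> {r. Re r = -T}"
      using c T by (auto simp: a1_def a2_def a3_def a4_def closed_segment_same_Re closed_segment_same_Im closed_segment_eq_real_ivl)
    have far: "T \<le> norm r" if "r \<in> closed_segment a1 a2 \<union> closed_segment a3 a4 \<union> closed_segment a4 a1" for r
      using that segs abs_Im_le_cmod[of r] abs_Re_le_cmod[of r] T by auto
    have ci: "P contour_integrable_on (linepath a1 a2)" "P contour_integrable_on (linepath a2 a3)"
      "P contour_integrable_on (linepath a3 a4)" "P contour_integrable_on (linepath a4 a1)"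
      using box unfolding rectpath_def Let_def
      by (intro contour_integrable_continuous_linepath contP;
          simp add: a1_def a2_def a3_def a4_def path_image_join)+
    have "J = contour_integral (linepath a1 a2) P + contour_integral (linepath a2 a3) P +
        contour_integral (linepath a3 a4) P + contour_integral (linepath a4 a1) P"
      unfolding R[symmetric] rectpath_def Let_def using ci
      by (simp add: a1_def a2_def a3_def a4_def contour_integrable_join)
    moreover have "contour_integral (linepath a2 a3) P = \<i> * integral {-T..T} (\<lambda>s. P (Complex c s))"
      using T by (intro contour_integral_linepath_same_Re) (auto simp: a2_def a3_def)
    ultimately have split: "J - \<i> * integral {-T..T} (\<lambda>s. P (Complex c s)) = contour_integral (linepath a1 a2) P +
        contour_integral (linepath a3 a4) P + contour_integral (linepath a4 a1) P"
      by simp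
    have len: "norm (a2 - a1) \<le> 2 * T" "norm (a4 - a3) \<le> 2 * T" "norm (a1 - a4) \<le> 2 * T"
      using c T by (auto intro!: order_trans[OF cmod_le] simp: a1_def a2_def a3_def a4_def)
    have side: "norm (contour_integral (linepath a b) P) \<le> 2 * C / T"
      if "P contour_integrable_on linepath a b" "\<And>r. r \<in> closed_segment a b \<Longrightarrow> T \<le> norm r"
        "norm (b - a) \<le> 2 * T" for a b
    proof -
      have "norm (contour_integral (linepath a b) P) \<le> C / T\<^sup>2 * norm (b - a)"
        using that C0 T by (intro contour_integral_bound_linepath Cbig) auto
      also have "\<dots> \<le> C / T\<^sup>2 * (2 * T)"
        using that C0 by (intro mult_left_mono) auto
      also have "\<dots> = 2 * C / T" using T by (simp add: power2_eq_square)
      finally show ?thesis .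
    qed
    have "norm (J - \<i> * integral {-T..T} (\<lambda>s. P (Complex c s))) \<le> 2 * C / T + 2 * C / T + 2 * C / T"
      unfolding split using far by (intro norm_triangle_mono side ci len) auto
    then show ?thesis by (simp add: add_divide_distrib)
  qed
  have "((\<lambda>T. J - \<i> * integral {-T..T} (\<lambda>s. P (Complex c s))) \<longlongrightarrow> 0) at_top"
  proof (rule Lim_null_comparison)
    show "\<forall>\<^sub>F T in at_top. norm (J - \<i> * integral {-T..T} (\<lambda>s. P (Complex c s))) \<le> 6 * C / T"
      using rect by (auto simp: eventually_at_top_linorder)
    show "((\<lambda>T. 6 * C / T) \<longlongrightarrow> 0) at_top"
      by (intro tendsto_divide_0[OF tendsto_const] filterlim_at_top_imp_at_infinity filterlim_ident)
  qed
  moreover have "((\<lambda>T. J - \<i> * integral {-T..T} (\<lambda>s. P (Complex c s))) \<longlongrightarrow> J - vertical_integral c P) at_top"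
    by (intro tendsto_intros lim)
  ultimately have "J - vertical_integral c P = 0"
    by (rule tendsto_unique[OF trivial_limit_at_top_linorder, symmetric])
  then show "vertical_integral c (line_integrand x \<nu> K z) =
      contour_integral (circlepath 0 (1/2)) (line_integrand x \<nu> K z)"
    by (simp add: J_def P_def)
qed

section \<open>From vertical lines to loops around 1\<close>

definition slit_plane :: "complex set" where
  "slit_plane = - complex_of_real ` {..1}"

lemma slit_plane_iff: "t \<in> slit_plane \<longleftrightarrow> Im t \<noteq> 0 \<or> Re t > 1"
proof -
  have "t \<in> complex_of_real ` {..1} \<longleftrightarrow> Im t = 0 \<and> Re t \<le> 1"
    by (metis (no_types, lifting) Im_complex_of_real Re_complex_of_real atMost_iff complex_is_Real_iff
        imageE image_eqI of_real_Re)
  then show ?thesis by (auto simp: slit_plane_def)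
qed

lemma open_slit_plane: "open slit_plane"
proof -
  have "slit_plane = {t. Im t < 0} \<union> {t. Im t > 0} \<union> {t. Re t > 1}"
    by (auto simp: slit_plane_iff)
  show ?thesis unfolding \<open>slit_plane = _\<close>
    by (intro open_Un open_halfspace_Im_lt open_halfspace_Im_gt open_halfspace_Re_gt)
qed

lemma starlike_slit_plane: "starlike slit_plane"
  unfolding starlike_def
proof (intro bexI ballI)
  fix t assume t: "t \<in> slit_plane"
  show "closed_segment 2 t \<subseteq> slit_plane"
  proof
    fix s assume "s \<in> closed_segment 2 t"
    then obtain u where u: "0 \<le> u" "u \<le> 1" and s: "s = (1 - u) *\<^sub>R 2 + u *\<^sub>R t"
      by (auto simp: closed_segment_def)
    show "s \<in> slit_plane"
    proof (cases "u = 0 \<or> Im t \<noteq> 0")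
      case True
      then show ?thesis using u by (auto simp: s slit_plane_iff)
    next
      case False
      then have "Re t > 1" "u > 0" using t u by (auto simp: slit_plane_iff)
      then have "(1 - u) * 2 + u * Re t > (1 - u) * 1 + u * 1"
        using u by (intro add_le_less_mono mult_left_mono mult_strict_left_mono) auto
      then show ?thesis by (simp add: s slit_plane_iff)
    qed
  qed
qed (simp add: slit_plane_iff)

text \<open>
  On the slit plane $t$ and $t - 1$ lie in the same open half-plane or are both positive, so their arguments
  differ by less than $\pi$ and the principal logarithms subtract without a correction.
\<close>

lemma slit_plane_powr:
  assumes t: "t \<in> slit_plane"
  shows "t powr (1 - \<nu>) * (t - 1) powr \<nu> = (1 - 1 / t) powr \<nu> * t"
proof -
  have ne: "t \<noteq> 0" "t - 1 \<noteq> 0" using t by (auto simp: slit_plane_iff complex_eq_iff)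
  have neg: "- pi < Im (Ln w) \<and> Im (Ln w) < 0" if "Im w < 0" for w
  proof -
    have "w \<noteq> 0" using that by auto
    then show ?thesis
      using Im_Ln_pos_le[of w] Im_Ln_le_pi[of w] mpi_less_Im_Ln[of w] that by linarith
  qed
  have "\<bar>Im (Ln (t - 1) - Ln t)\<bar> < pi"
  proof (cases "Im t" "0::real" rule: linorder_cases)
    case less
    then show ?thesis
      using neg[of t] neg[of "t - 1"] by (auto simp: abs_less_iff)
  next
    case greater
    then show ?thesis
      using Im_Ln_pos_lt[of t] Im_Ln_pos_lt[of "t - 1"] ne by (auto simp: abs_less_iff)
  next
    case equal
    then have "Re t > 1" using t by (auto simp: slit_plane_iff)
    then have "Im (Ln t) = 0" "Im (Ln (t - 1)) = 0"
      using equal ne by (auto simp: Im_Ln_eq_0)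
    then show ?thesis by simp
  qed
  moreover have "exp (Ln (t - 1) - Ln t) = 1 - 1 / t"
    using ne by (simp add: exp_diff diff_divide_distrib)
  ultimately have "Ln (1 - 1 / t) = Ln (t - 1) - Ln t"
    by (intro Ln_unique) (auto simp: abs_less_iff)
  moreover have "1 - 1 / t \<noteq> 0" using ne by (simp add: divide_simps)
  ultimately have "(1 - 1 / t) powr \<nu> = (t - 1) powr \<nu> / t powr \<nu>"
    using ne by (simp add: powr_def exp_diff right_diff_distrib)
  moreover have "t powr (1 - \<nu>) = t / t powr \<nu>"
    using ne by (simp add: powr_diff)
  ultimately show ?thesis by simp
qed

text \<open>
  The change of variables $r = 1/t$; the factor $t^{-2}$ is the Jacobian up to sign, the sign
  being absorbed by the orientation.
\<close>

lemma loop_integrand_eq_line_integrand: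
  assumes t: "t \<in> slit_plane"
  shows "loop_integrand x \<nu> K z t = line_integrand x \<nu> K z (1 / t) / t\<^sup>2"
proof -
  have ne: "t \<noteq> 0" "1 - t \<noteq> 0" using t by (auto simp: slit_plane_iff complex_eq_iff)
  have "1 / (1 / t - 1) / t\<^sup>2 = 1 / (t * (1 - t))"
  proof -
    have "1 / t - 1 = (1 - t) / t" using ne by (simp add: diff_divide_distrib)
    then show ?thesis using ne by (simp add: power2_eq_square)
  qed
  then have e1: "exp (x * t * z) / (t * (1 - t)) = exp (x * z * t) / (1 / t - 1) / t\<^sup>2"
    by (metis (no_types, lifting) mult.commute mult.left_commute times_divide_eq_right mult.right_neutral)
  have e2: "z * t powr (1 - \<nu>) * (t - 1) powr \<nu> = z * (1 - 1 / t) powr \<nu> * t"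
    using slit_plane_powr[OF t, of \<nu>] by (simp add: mult.assoc)
  have e3: "w / (1 / t) = w * t" for w by simp
  show ?thesis
    unfolding loop_integrand_def line_integrand_def e1 e2 e3 by simp
qed

lemma holomorphic_loop_integrand:
  assumes "K \<in> H0"
  shows "loop_integrand x \<nu> K z holomorphic_on slit_plane"
proof -
  have hol: "K holomorphic_on UNIV" using assms by (auto simp: H0_def)
  have "(\<lambda>t. z * t powr (1 - \<nu>) * (t - 1) powr \<nu>) holomorphic_on slit_plane"
    by (intro holomorphic_intros) (auto simp: complex_nonpos_Reals_iff slit_plane_iff)
  then have "(K \<circ> (\<lambda>t. z * t powr (1 - \<nu>) * (t - 1) powr \<nu>)) holomorphic_on slit_plane"
    by (rule holomorphic_on_compose) (rule holomorphic_on_subset[OF hol], simp)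
  then show ?thesis
    unfolding loop_integrand_def o_def
    by (intro holomorphic_intros) (auto simp: slit_plane_iff)
qed

text \<open>
  A function with bounded derivative on a half-disc is Lipschitz there and so extends continuously to
  the boundary point $0$. The sign \<open>\<sigma>\<close> selects the upper or the lower half-disc; the
  two limits differ in general.
\<close>

lemma half_disc_limit:
  assumes der: "\<And>t. t \<in> slit_plane \<Longrightarrow> (\<Phi> has_field_derivative G t) (at t)"
    and bdd: "\<And>t. t \<in> slit_plane \<Longrightarrow> norm t \<le> 1/2 \<Longrightarrow> norm (G t) \<le> C"
    and \<sigma>: "\<sigma> = 1 \<or> \<sigma> = -1"
  obtains l where "(\<Phi> \<longlongrightarrow> l) (at 0 within {t. \<sigma> * Im t > 0} \<inter> ball 0 (1/2))"
proof -
  let ?S = "{t. \<sigma> * Im t > 0} \<inter> ball 0 (1/2)"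
  have sub: "?S \<subseteq> slit_plane" using \<sigma> by (auto simp: slit_plane_iff)
  have conv: "convex ?S"
    using \<sigma> convex_halfspace_Im_gt[of 0] convex_halfspace_Im_lt[of 0]
    by (intro convex_Int convex_ball) auto
  have lip: "norm (\<Phi> a - \<Phi> b) \<le> C * norm (a - b)" if "a \<in> ?S" "b \<in> ?S" for a b
  proof (rule field_differentiable_bound[OF conv _ _ that])
    fix t assume t: "t \<in> ?S"
    then have "t \<in> slit_plane" "norm t \<le> 1/2" using sub by auto
    then show "(\<Phi> has_field_derivative G t) (at t within ?S)" "norm (G t) \<le> C"
      by (auto intro: has_field_derivative_at_within der bdd)
  qed
  have "C-lipschitz_on ?S \<Phi>"
  proof (rule lipschitz_onI)
    have "\<i> * of_real (\<sigma> / 4) \<in> slit_plane" "norm (\<i> * of_real (\<sigma> / 4)) \<le> 1/2"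
      using \<sigma> by (auto simp: slit_plane_iff norm_mult)
    from bdd[OF this] show "C \<ge> 0" by (rule order_trans[OF norm_ge_zero])
  qed (use lip in \<open>auto simp: dist_norm\<close>)
  then have uc: "uniformly_continuous_on ?S \<Phi>" by (rule lipschitz_on_uniformly_continuous)
  have "0 \<in> closure ?S"
    unfolding closure_approachable
  proof (intro allI impI)
    fix e :: real assume "e > 0"
    define y where "y = \<i> * of_real (\<sigma> * (min e (1/2) / 2))"
    have "y \<in> ?S" "dist y 0 < e"
      using \<open>e > 0\<close> \<sigma> by (auto simp: y_def norm_mult min_def)
    then show "\<exists>y\<in>?S. dist y 0 < e" by blast
  qed
  from uniformly_continuous_on_extension_at_closure[OF uc this] that show ?thesis by blast
qed

text \<open>
  Both integrals equal the limit of a primitive at $0$ from the upper half-plane minus its limit from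
  the lower one. For the loop this follows from its staying in the slit plane and from the sides on which
  it leaves and reaches $0$. Run upwards, the line is mapped by $t = 1/r$ to a curve from the upper to the
  lower side of $0$, and the sign of the Jacobian $-1/r^2$ makes up for the opposite orientation.
\<close>

proposition loop_integral_eq_vertical_integral:
  assumes K: "K \<in> H0" and Re_nu: "Re \<nu> < 0" and c: "0 < c" "c < 1" and \<gamma>: "loop_around_1 \<gamma>"
  shows "(loop_integrand x \<nu> K z has_contour_integral vertical_integral c (line_integrand x \<nu> K z)) \<gamma>"
proof -
  define G where "G = loop_integrand x \<nu> K z"
  define P where "P = line_integrand x \<nu> K z"
  have GP: "G t = P (1 / t) / t\<^sup>2" if "t \<in> slit_plane" for t
    using loop_integrand_eq_line_integrand[OF that] by (simp add: G_def P_def)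
  have holG: "G holomorphic_on slit_plane" unfolding G_def by (rule holomorphic_loop_integrand[OF K])
  obtain \<Phi> where \<Phi>: "\<And>t. t \<in> slit_plane \<Longrightarrow> (\<Phi> has_field_derivative G t) (at t)"
    using holomorphic_starlike_primitive[OF holomorphic_on_imp_continuous_on[OF holG] starlike_slit_plane
        open_slit_plane finite.emptyI] holG open_slit_plane
    by (metis DiffD1 holomorphic_on_imp_differentiable_at)
  obtain C where C: "\<And>r. norm r \<ge> 2 \<Longrightarrow> norm (P r) \<le> C / (norm r)\<^sup>2"
    unfolding P_def by (rule line_integrand_decay[OF K Re_nu, of x z]) blast
  have bdd: "norm (G t) \<le> C" if "t \<in> slit_plane" "norm t \<le> 1/2" for t
  proof -
    have "t \<noteq> 0" using that by (auto simp: slit_plane_iff)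
    then have "norm (P (1 / t)) \<le> C * (norm t)\<^sup>2"
      using C[of "1 / t"] that by (simp add: norm_divide field_simps)
    then show ?thesis using \<open>t \<noteq> 0\<close> by (simp add: GP[OF that(1)] norm_divide norm_power divide_le_eq)
  qed
  obtain l1 where l1: "(\<Phi> \<longlongrightarrow> l1) (at 0 within {t. 1 * Im t > 0} \<inter> ball 0 (1/2))"
    by (rule half_disc_limit[of \<Phi> G C 1]) (use \<Phi> bdd in blast)+
  obtain l2 where l2: "(\<Phi> \<longlongrightarrow> l2) (at 0 within {t. - 1 * Im t > 0} \<inter> ball 0 (1/2))"
    by (rule half_disc_limit[of \<Phi> G C "-1"]) (use \<Phi> bdd in blast)+
  have upper: "((\<lambda>s. \<Phi> (p s)) \<longlongrightarrow> l1) F"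
    if "(p \<longlongrightarrow> 0) F" "\<forall>\<^sub>F s in F. Im (p s) > 0" for p :: "real \<Rightarrow> complex" and F
  proof (rule filterlim_compose[OF l1])
    have "\<forall>\<^sub>F s in F. dist (p s) 0 < 1/2" using that(1) by (rule tendstoD) simp
    with that(2) have "\<forall>\<^sub>F s in F. p s \<in> {t. 1 * Im t > 0} \<inter> ball 0 (1/2) \<and> p s \<noteq> 0"
      by eventually_elim auto
    then show "filterlim p (at 0 within {t. 1 * Im t > 0} \<inter> ball 0 (1/2)) F"
      using that(1) by (simp add: filterlim_at)
  qed
  have lower: "((\<lambda>s. \<Phi> (p s)) \<longlongrightarrow> l2) F"
    if "(p \<longlongrightarrow> 0) F" "\<forall>\<^sub>F s in F. Im (p s) < 0" for p :: "real \<Rightarrow> complex" and F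
  proof (rule filterlim_compose[OF l2])
    have "\<forall>\<^sub>F s in F. dist (p s) 0 < 1/2" using that(1) by (rule tendstoD) simp
    with that(2) have "\<forall>\<^sub>F s in F. p s \<in> {t. - 1 * Im t > 0} \<inter> ball 0 (1/2) \<and> p s \<noteq> 0"
      by eventually_elim auto
    then show "filterlim p (at 0 within {t. - 1 * Im t > 0} \<inter> ball 0 (1/2)) F"
      using that(1) by (simp add: filterlim_at)
  qed

  have line: "vertical_integral c P = l1 - l2"
  proof -
    define r where "r s = of_real c + \<i> * of_real s" for s :: real
    \<comment> \<open>the image of the line in the slit plane: a circle through \<open>0\<close>\<close>
    define t where "t s = 1 / r s" for s
    have r0: "r s \<noteq> 0" for s using c by (auto simp: r_def complex_eq_iff)
    have Imt: "Im (t s) = - s / (c\<^sup>2 + s\<^sup>2)" "Re (t s) = c / (c\<^sup>2 + s\<^sup>2)" for s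
      by (auto simp: t_def r_def Im_divide Re_divide power2_eq_square)
    have sq: "c\<^sup>2 + s\<^sup>2 > 0" for s using c by (simp add: add_pos_nonneg)
    have tin: "t s \<in> slit_plane" for s
    proof (cases "s = 0")
      case True
      then show ?thesis using c by (simp add: slit_plane_iff Imt power2_eq_square)
    next
      case False
      then show ?thesis using sq[of s] by (simp add: slit_plane_iff Imt)
    qed
    have dt: "(t has_vector_derivative (- \<i> / (r s)\<^sup>2)) (at s)" for s
    proof -
      have "((\<lambda>w. 1 / (of_real c + \<i> * w)) has_field_derivative (- \<i> / (r s)\<^sup>2)) (at (of_real s))"
        using r0[of s] by (auto intro!: derivative_eq_intros simp: r_def power2_eq_square)
      then show ?thesis unfolding t_def r_def by (rule has_vector_derivative_real_field)
    qed
    have d: "((\<lambda>s. - \<Phi> (t s)) has_vector_derivative (\<i> * P (Complex c s))) (at s)" for s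
    proof -
      have "((\<Phi> \<circ> t) has_vector_derivative (- \<i> / (r s)\<^sup>2 * G (t s))) (at s)"
        by (rule field_vector_diff_chain_at[OF dt \<Phi>[OF tin]])
      moreover have "- \<i> / (r s)\<^sup>2 * G (t s) = - (\<i> * P (r s))"
      proof -
        have "G (t s) = P (r s) * (r s)\<^sup>2"
          using GP[OF tin[of s]] by (simp add: t_def power_divide)
        then show ?thesis using r0[of s] by simp
      qed
      ultimately have "((\<lambda>s. - \<Phi> (t s)) has_vector_derivative - (- (\<i> * P (r s)))) (at s)"
        unfolding o_def by (intro has_vector_derivative_minus) simp
      then show ?thesis by (simp add: r_def Complex_eq)
    qed
    have int: "\<i> * integral {-T..T} (\<lambda>s. P (Complex c s)) = \<Phi> (t (- T)) - \<Phi> (t T)" if "T > 0" for T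
    proof -
      have "((\<lambda>s. \<i> * P (Complex c s)) has_integral (- \<Phi> (t T) - - \<Phi> (t (- T)))) {-T..T}"
        by (rule fundamental_theorem_of_calculus)
          (use that in \<open>simp_all add: has_vector_derivative_at_within[OF d]\<close>)
      then have "integral {-T..T} (\<lambda>s. \<i> * P (Complex c s)) = - \<Phi> (t T) - - \<Phi> (t (- T))"
        by (rule integral_unique)
      then show ?thesis by simp
    qed
    have rinf: "filterlim (\<lambda>T. r (\<sigma> * T)) at_infinity at_top" if "\<sigma> = 1 \<or> \<sigma> = -1" for \<sigma>
    proof (rule filterlim_norm_at_top_imp_at_infinity)
      show "filterlim (\<lambda>T. norm (r (\<sigma> * T))) at_top at_top"
      proof (rule filterlim_at_top_mono[OF filterlim_ident])
        have "T \<le> norm (r (\<sigma> * T))" for T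
          using abs_Im_le_cmod[of "r (\<sigma> * T)"] that by (auto simp: r_def)
        then show "\<forall>\<^sub>F T in at_top. T \<le> norm (r (\<sigma> * T))" by simp
      qed
    qed
    have t0: "((\<lambda>T. t (\<sigma> * T)) \<longlongrightarrow> 0) at_top" if "\<sigma> = 1 \<or> \<sigma> = -1" for \<sigma>
      unfolding t_def by (intro tendsto_divide_0[OF tendsto_const] rinf that)
    have "((\<lambda>T. \<Phi> (t (- T)) - \<Phi> (t T)) \<longlongrightarrow> l1 - l2) at_top"
    proof (intro tendsto_diff upper lower)
      show "((\<lambda>T. t (- T)) \<longlongrightarrow> 0) at_top" "(t \<longlongrightarrow> 0) at_top"
        using t0[of "-1"] t0[of 1] by simp_all
      have "Im (t (- T)) > 0" "Im (t T) < 0" if "T > 0" for T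
        using sq[of T] that by (simp_all add: Imt divide_neg_pos)
      then show "\<forall>\<^sub>F T in at_top. Im (t (- T)) > 0" "\<forall>\<^sub>F T in at_top. Im (t T) < 0"
        by (auto intro: eventually_mono[OF eventually_gt_at_top[of 0]])
    qed
    moreover have "\<forall>\<^sub>F T in at_top. \<Phi> (t (- T)) - \<Phi> (t T) = \<i> * integral {-T..T} (\<lambda>s. P (Complex c s))"
      using int by (auto intro: eventually_mono[OF eventually_gt_at_top[of 0]])
    ultimately have "((\<lambda>T. \<i> * integral {-T..T} (\<lambda>s. P (Complex c s))) \<longlongrightarrow> l1 - l2) at_top"
      by (rule Lim_transform_eventually)
    with line_integral_eq_circle_integral(3)[OF K Re_nu c, of x z] show ?thesis
      unfolding P_def by (rule tendsto_unique[OF trivial_limit_at_top_linorder])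
  qed

  have valid: "valid_path \<gamma>" and start: "\<gamma> 0 = 0" and fin: "\<gamma> 1 = 0"
    and avoid: "\<And>s. s \<in> {0<..<1} \<Longrightarrow> \<gamma> s \<in> slit_plane"
    and near0: "\<forall>\<^sub>F s in at_right 0. Im (\<gamma> s) < 0" and near1: "\<forall>\<^sub>F s in at_left 1. Im (\<gamma> s) > 0"
    using \<gamma> by (auto simp: loop_around_1_def pathstart_def pathfinish_def slit_plane_def)
  have cont\<gamma>: "continuous_on {0..1} \<gamma>"
    using valid by (simp add: valid_path_def piecewise_C1_differentiable_on_def)
  obtain S where S: "finite S" and diff: "\<And>s. s \<in> {0..1} - S \<Longrightarrow> \<gamma> differentiable (at s)"
    using valid unfolding valid_path_def piecewise_C1_differentiable_on_def C1_differentiable_on_eq by blast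
  \<comment> \<open>the composite of primitive and loop, with the one-sided limits as end values: it is continuous on the closed interval although \<open>\<Phi>\<close> need not have a limit at \<open>0\<close> in the slit plane\<close>
  define \<Psi> where "\<Psi> s = (if s = 0 then l2 else if s = 1 then l1 else \<Phi> (\<gamma> s))" for s
  have \<Psi>eq: "\<forall>\<^sub>F s in nhds s0. \<Psi> s = \<Phi> (\<gamma> s)" if "s0 \<in> {0<..<1}" for s0
  proof -
    have "\<forall>\<^sub>F s in nhds s0. s \<in> {0<..<1}" using that by (intro eventually_nhds_in_open) auto
    then show ?thesis by eventually_elim (auto simp: \<Psi>_def)
  qed
  have "continuous_on {0..1} \<Psi>"
  proof (rule continuous_on_IccI)
    have "(\<gamma> \<longlongrightarrow> 0) (at_right 0)"
      using continuous_on_Icc_at_rightD[OF cont\<gamma>] start by simp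
    from lower[OF this near0] show "(\<Psi> \<longlongrightarrow> \<Psi> 0) (at_right 0)"
    proof (rule Lim_transform_eventually[where f = "\<lambda>s. \<Phi> (\<gamma> s)", THEN tendsto_eq_rhs])
      show "\<forall>\<^sub>F s in at_right 0. \<Phi> (\<gamma> s) = \<Psi> s"
        unfolding eventually_at_right_field by (auto simp: \<Psi>_def intro!: exI[of _ 1])
    qed (simp add: \<Psi>_def)
    have "(\<gamma> \<longlongrightarrow> 0) (at_left 1)"
      using continuous_on_Icc_at_leftD[OF cont\<gamma>] fin by simp
    from upper[OF this near1] show "(\<Psi> \<longlongrightarrow> \<Psi> 1) (at_left 1)"
    proof (rule Lim_transform_eventually[where f = "\<lambda>s. \<Phi> (\<gamma> s)", THEN tendsto_eq_rhs])
      show "\<forall>\<^sub>F s in at_left 1. \<Phi> (\<gamma> s) = \<Psi> s"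
        unfolding eventually_at_left_field by (auto simp: \<Psi>_def intro!: exI[of _ 0])
    qed (simp add: \<Psi>_def)
    fix s :: real assume s: "0 < s" "s < 1"
    have "isCont \<gamma> s" using cont\<gamma> s by (intro continuous_on_interior[of "{0..1}"]) auto
    moreover have "isCont \<Phi> (\<gamma> s)" using s by (intro DERIV_isCont[OF \<Phi>] avoid) auto
    ultimately have "isCont (\<lambda>s. \<Phi> (\<gamma> s)) s" by (rule isCont_o2)
    then have "isCont \<Psi> s" using isCont_cong[OF \<Psi>eq[of s]] s by simp
    then show "(\<Psi> \<longlongrightarrow> \<Psi> s) (at s)" by (simp add: isCont_def)
  qed simp
  moreover have "(\<Psi> has_vector_derivative G (\<gamma> s) * vector_derivative \<gamma> (at s within {0..1})) (at s)"
    if s: "s \<in> {0<..<1} - S" for s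
  proof -
    have "(\<gamma> has_vector_derivative vector_derivative \<gamma> (at s)) (at s)"
      using diff[of s] s by (simp add: vector_derivative_works)
    moreover have "vector_derivative \<gamma> (at s within {0..1}) = vector_derivative \<gamma> (at s)"
      using s by (simp add: at_within_Icc_at)
    ultimately have "((\<Phi> \<circ> \<gamma>) has_vector_derivative
        vector_derivative \<gamma> (at s within {0..1}) * G (\<gamma> s)) (at s)"
      using s by (simp add: field_vector_diff_chain_at \<Phi> avoid)
    then have "((\<lambda>s. \<Phi> (\<gamma> s)) has_vector_derivative
        G (\<gamma> s) * vector_derivative \<gamma> (at s within {0..1})) (at s)"
      by (simp add: o_def mult.commute)
    then show ?thesis
      by (rule has_vector_derivative_transform_within_open[of _ _ _ "{0<..<1}"])
        (use s in \<open>auto simp: \<Psi>_def\<close>)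
  qed
  ultimately have "((\<lambda>s. G (\<gamma> s) * vector_derivative \<gamma> (at s within {0..1})) has_integral (\<Psi> 1 - \<Psi> 0)) {0..1}"
    by (intro fundamental_theorem_of_calculus_interior_strong[OF S]) auto
  then have "(G has_contour_integral (l1 - l2)) \<gamma>"
    by (simp add: has_contour_integral_def \<Psi>_def)
  then show ?thesis using line by (simp add: G_def P_def)
qed

section \<open>The inversion formulas\<close>

theorem corollary4p1:
  fixes x \<nu> :: complex and K :: "complex \<Rightarrow> complex"
  assumes "x \<notin> \<real>\<^sub>\<le>\<^sub>0" and "x \<noteq> 1" and "Re \<nu> < 0" and "K \<in> H0"
  shows "(\<exists>!E. E \<in> H0 \<and> op_L x \<nu> E = K) \<and>
    (\<forall>z \<gamma>. loop_around_1 \<gamma> \<longrightarrow>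
      loop_integrand x \<nu> K z contour_integrable_on \<gamma> \<and>
      inv_into H0 (op_L x \<nu>) K z =
        (1 - x) / (2 * \<i> * of_real pi * x) * exp ((1 - x) * z) *
          contour_integral \<gamma> (loop_integrand x \<nu> K z)) \<and>
    (\<forall>z c\<^sub>0. 0 < c\<^sub>0 \<and> c\<^sub>0 < 1 \<longrightarrow>
      vertical_integrable c\<^sub>0 (line_integrand x \<nu> K z) \<and>
      inv_into H0 (op_L x \<nu>) K z =
        (1 - x) / (2 * \<i> * of_real pi * x) * exp ((1 - x) * z) *
          vertical_integral c\<^sub>0 (line_integrand x \<nu> K z))"
proof -
  interpret inversion_kernel x \<nu> by unfold_locales (use assms in auto)
  note K = \<open>K \<in> H0\<close>
  have inv: "inv_into H0 (op_L x \<nu>) K = inverse_L K"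
    using inv_into_f_f[OF op_L_inj_on inverse_L_in_H0[OF K]] op_L_inverse_L[OF K] by simp
  have unique: "\<exists>!E. E \<in> H0 \<and> op_L x \<nu> E = K"
    using inverse_L_in_H0[OF K] op_L_inverse_L[OF K] op_L_inj_on by (auto dest: inj_onD)
  have line: "vertical_integrable c (line_integrand x \<nu> K z)"
    "inverse_L K z = (1 - x) / (2 * \<i> * of_real pi * x) * exp ((1 - x) * z) *
        vertical_integral c (line_integrand x \<nu> K z)"
    if "0 < c" "c < 1" for c z
    using line_integral_eq_circle_integral(1,2)[OF K Re_nu that, of x z]
    by (simp_all add: inverse_L_def untwisted_inverse_def)
  have loop: "(loop_integrand x \<nu> K z has_contour_integral
      vertical_integral (1/2) (line_integrand x \<nu> K z)) \<gamma>" if "loop_around_1 \<gamma>" for z \<gamma>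
    by (rule loop_integral_eq_vertical_integral[OF K Re_nu _ _ that]) auto
  show ?thesis
    unfolding inv
  proof (intro conjI allI impI unique)
    fix z \<gamma> assume \<gamma>: "loop_around_1 \<gamma>"
    show "loop_integrand x \<nu> K z contour_integrable_on \<gamma>"
      using loop[OF \<gamma>] by (auto simp: contour_integrable_on_def)
    show "inverse_L K z = (1 - x) / (2 * \<i> * of_real pi * x) * exp ((1 - x) * z) *
          contour_integral \<gamma> (loop_integrand x \<nu> K z)"
      using line(2)[of "1/2" z] contour_integral_unique[OF loop[OF \<gamma>]] by simp
  qed (use line in auto)
qed

end
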